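(* Let $C>0$ and $A\ge0$ be constants and consider the isothermal system \[ \partial_t\rho+\partial_x(\rho u)=0,\qquad \partial_tu+u\,\partial_xu+A\,\partial_x(\ln\rho)=-Cu+C\int_{\mathbb R}\rho_0u_0\,dx,\qquad x\in\mathbb R,\ t>0, \] with initial data $(\rho,u)|_{t=0}=(\rho_0,u_0)$ such that $\partial_xu_0\pm\sqrt A\,\frac{\partial_x\rho_0}{\rho_0}\in L^\infty(\mathbb R)$. If \[ \partial_xu_0(x)\ge -C+\sqrt A\left|\frac{\partial_x\rho_0(x)}{\rho_0(x)}\right|\qquad\text{for all }x\in\mathbb R, \] then the system has a global classical solution.
   Context: This system is the Euler-Alignment system with isothermal pressure $p(\rho)=A\rho$ and constant influence function $\psi\equiv C$, where $\rho>0$ is a probability density ($\|\rho(\cdot,t)\|_{L^1}=1$) and the momentum $\int\rho u\,dx=\int\rho_0u_0\,dx$ is conserved. The initial data are regular enough that a classical solution exists locally in time. *)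

theory Defs
  imports "HOL-Analysis.Analysis"
begin

text \<open>Functions of time and space are curried with time first, so \<open>f t\<close> is the profile
  at time \<open>t\<close>. A time interval \<open>J\<close> is either \<open>{0..<T}\<close> or \<open>{0..}\<close>.\<close>

text \<open>Class \<open>C\<^sup>1\<close> on \<open>J \<times> \<real>\<close>, up to \<open>t = 0\<close>, where the time derivative is one-sided.
  Continuity of the function itself follows from that of its partial derivatives.\<close>

definition C1_spacetime :: "real set \<Rightarrow> (real \<Rightarrow> real \<Rightarrow> real) \<Rightarrow> bool" where
  "C1_spacetime J f \<longleftrightarrow> (\<exists>ft fx.
     (\<forall>t\<in>J. \<forall>x. ((\<lambda>s. f s x) has_real_derivative ft t x) (at t within J)) \<and>
     (\<forall>t\<in>J. \<forall>x. (f t has_real_derivative fx t x) (at x)) \<and>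
     continuous_on (J \<times> UNIV) (\<lambda>(t, x). ft t x) \<and>
     continuous_on (J \<times> UNIV) (\<lambda>(t, x). fx t x))"

definition Linfty :: "(real \<Rightarrow> real) \<Rightarrow> bool" where
  "Linfty f \<longleftrightarrow> f \<in> borel_measurable lborel \<and> (\<exists>M. AE x in lborel. \<bar>f x\<bar> \<le> M)"

definition momentum :: "(real \<Rightarrow> real) \<Rightarrow> (real \<Rightarrow> real) \<Rightarrow> real" where
  "momentum r v = (LINT x|lborel. r x * v x)"

definition admissible_state :: "(real \<Rightarrow> real) \<Rightarrow> (real \<Rightarrow> real) \<Rightarrow> bool" where
  "admissible_state r v \<longleftrightarrow>
     (\<forall>x. r x > 0) \<and> integrable lborel r \<and> (LINT x|lborel. r x) = 1 \<and>
     integrable lborel (\<lambda>x. r x * v x)"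

text \<open>The alignment force \<open>\<integral> C (u(y) - u(x)) \<rho>(y) dy\<close> reduces to
  \<open>- C u + C \<integral> \<rho>\<^sub>0 u\<^sub>0 dx\<close> because the density has unit mass and the momentum is
  conserved at all times; both are part of the notion of solution.\<close>

definition classical_solution ::
  "real \<Rightarrow> real \<Rightarrow> (real \<Rightarrow> real) \<Rightarrow> (real \<Rightarrow> real) \<Rightarrow> real set \<Rightarrow>
   (real \<Rightarrow> real \<Rightarrow> real) \<Rightarrow> (real \<Rightarrow> real \<Rightarrow> real) \<Rightarrow> bool" where
  "classical_solution A C \<rho>0 u0 J \<rho> u \<longleftrightarrow>
     C1_spacetime J \<rho> \<and> C1_spacetime J u \<and>
     \<rho> 0 = \<rho>0 \<and> u 0 = u0 \<and>
     (\<forall>t\<in>J. admissible_state (\<rho> t) (u t) \<and> momentum (\<rho> t) (u t) = momentum \<rho>0 u0) \<and>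
     (\<forall>t\<in>J. \<forall>x. t > 0 \<longrightarrow>
        deriv (\<lambda>s. \<rho> s x) t + deriv (\<lambda>y. \<rho> t y * u t y) x = 0 \<and>
        deriv (\<lambda>s. u s x) t + u t x * deriv (u t) x + A * deriv (\<lambda>y. ln (\<rho> t y)) x
          = - C * u t x + C * momentum \<rho>0 u0)"

end

theory Submission imports Defs begin

text \<open>
  In the frame \<open>y = e\<^bsup>Ct\<^esup> (x - m t)\<close>, \<open>\<tau> = (e\<^bsup>Ct\<^esup> - 1) / C\<close>, where \<open>m\<close> is the conserved momentum,
  the system becomes the isothermal Euler system without forcing, with initial velocity
  \<open>v\<^sub>0 = u\<^sub>0 - m + C x\<close>. With \<open>c = \<surd>A\<close>, the hypothesis says exactly that the Riemann invariants
  \<open>r = v\<^sub>0 + c ln \<rho>\<^sub>0\<close> and \<open>s = v\<^sub>0 - c ln \<rho>\<^sub>0\<close> are nondecreasing: only rarefactions occur.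

  For \<open>c > 0\<close> take as coordinates the feet \<open>a \<le> b\<close> of the two characteristics through a point. There the
  invariants are the known functions \<open>r a\<close> and \<open>s b\<close>, and time and position solve a \<^emph>\<open>linear\<close> Goursat
  problem \<open>4 c \<tau>\<^sub>a\<^sub>b = s' b \<tau>\<^sub>a - r' a \<tau>\<^sub>b\<close>, which is globally solvable. Monotonicity of \<open>r\<close> and \<open>s\<close>
  keeps \<open>\<tau>\<^sub>b\<close> and \<open>- \<tau>\<^sub>a\<close> above \<open>1 / (2 c)\<close>, so that the coordinates invert to a global \<open>C\<^sup>1\<close> solution.

  For \<open>c = 0\<close> the characteristics are straight lines; the local solution is needed only to see that
  \<open>u\<^sub>0\<close> is of class \<open>C\<^sup>2\<close>, without which the density would not be \<open>C\<^sup>1\<close>.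
\<close>

section \<open>\<open>C\<^sup>1\<close> functions of time and space\<close>

text \<open>The linear equation is equality of mixed derivatives: position obeys x_b = (v + c) tau_b
  and x_a = (v - c) tau_a with v = (r a + s b) / 2, and equating x_ab with x_ba leaves the Goursat
  equation. Time 0 is the diagonal a = b, where x = a forces 2 c tau_b = - 2 c tau_a = 1. The
  unknown actually constructed is \<gamma> = - 2 c tau_ab. Its integral equation has coefficients r'
  / (4 c) and s' / (4 c), nonnegative by hypothesis, so it is solved inside the cone of nonnegative
  functions, and 2 c tau_b and - 2 c tau_a only grow away from the diagonal. Global existence is
  thus obtained at once, without continuation in time. The other obstacle is conservation: mass and
  momentum belong to the notion of solution, although u need not decay. Both are checked in particle
  coordinates. The particle map has Jacobian rho_0 / R, so the pressure force integrated over
  particles is a total derivative. As the flow expands, its boundary terms are bounded by rho_0 at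
  the ends, which for c > 0 tends to 0 along the integers.\<close>

definition has_C1 :: "real set \<Rightarrow> (real \<Rightarrow> real \<Rightarrow> real) \<Rightarrow> (real \<Rightarrow> real \<Rightarrow> real) \<Rightarrow> (real \<Rightarrow> real \<Rightarrow> real) \<Rightarrow> bool"
  where "has_C1 J f f1 f2 \<longleftrightarrow>
     (\<forall>t\<in>J. \<forall>x. ((\<lambda>p. f (fst p) (snd p)) has_derivative (\<lambda>d. f1 t x * fst d + f2 t x * snd d))
        (at (t, x) within J \<times> UNIV)) \<and>
     continuous_on (J \<times> UNIV) (\<lambda>p. f1 (fst p) (snd p)) \<and>
     continuous_on (J \<times> UNIV) (\<lambda>p. f2 (fst p) (snd p))"

text \<open>The rule on partial derivatives asks for convexity in the second variable only, so
  \<open>J\<close> may be any set of times and one-sided time derivatives at 0 are covered.\<close>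

lemma has_C1I:
  assumes d1: "\<And>t x. t \<in> J \<Longrightarrow> ((\<lambda>s. f s x) has_real_derivative f1 t x) (at t within J)"
    and d2: "\<And>t x. t \<in> J \<Longrightarrow> (f t has_real_derivative f2 t x) (at x)"
    and c1: "continuous_on (J \<times> UNIV) (\<lambda>p. f1 (fst p) (snd p))"
    and c2: "continuous_on (J \<times> UNIV) (\<lambda>p. f2 (fst p) (snd p))"
  shows "has_C1 J f f1 f2"
  unfolding has_C1_def
proof (intro conjI ballI allI c1 c2)
  fix t x :: real assume t: "t \<in> J"
  have "((\<lambda>(a, b). f a b) has_derivative
      (\<lambda>(a, b). (\<lambda>h. h * f1 t x) a + blinfun_apply ((\<lambda>a b. blinfun_mult_right (f2 a b)) t x) b))
      (at (t, x) within J \<times> UNIV)"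
  proof (rule has_derivative_partialsI)
    show "((\<lambda>a. f a x) has_derivative (\<lambda>h. h * f1 t x)) (at t within J)"
      using d1[OF t, of x] unfolding has_field_derivative_def by (simp add: mult.commute[of _ "f1 t x"])
    show "((\<lambda>y. f a y) has_derivative blinfun_apply (blinfun_mult_right (f2 a b))) (at b within UNIV)"
      if "a \<in> J" for a b
      using d2[OF that, of b] by (simp add: has_field_derivative_def)
    show "continuous (at (t, x) within J \<times> UNIV) (\<lambda>(x, y). blinfun_mult_right (f2 x y))"
    proof -
      have "continuous_on (J \<times> UNIV) (\<lambda>p. blinfun_mult_right (f2 (fst p) (snd p)))"
        by (intro bounded_linear.continuous_on[OF bounded_linear_blinfun_mult_right] c2)
      then show ?thesis
        using t unfolding continuous_on_eq_continuous_within split_beta by auto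
    qed
  qed auto
  then show "((\<lambda>p. f (fst p) (snd p)) has_derivative (\<lambda>d. f1 t x * fst d + f2 t x * snd d))
        (at (t, x) within J \<times> UNIV)"
    by (simp add: case_prod_unfold mult.commute[of "f1 t x"] mult.commute[of "f2 t x"])
qed

lemma continuous_on_curried_compose:
  fixes f :: "'a::topological_space \<Rightarrow> 'b::topological_space \<Rightarrow> 'c::topological_space"
  assumes "continuous_on (J \<times> UNIV) (\<lambda>p. f (fst p) (snd p))"
    and "continuous_on S a" "continuous_on S b" "\<And>s. s \<in> S \<Longrightarrow> a s \<in> J"
  shows "continuous_on S (\<lambda>s. f (a s) (b s))"
proof -
  have "continuous_on S (\<lambda>s. f (fst (a s, b s)) (snd (a s, b s)))"
    by (rule continuous_on_compose2[OF assms(1) continuous_on_Pair[OF assms(2,3)]]) (use assms(4) in auto)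
  then show ?thesis by simp
qed

lemma has_C1_cont_partial:
  assumes "has_C1 J f f1 f2" "continuous_on S a" "continuous_on S b" "\<And>s. s \<in> S \<Longrightarrow> a s \<in> J"
  shows "continuous_on S (\<lambda>s. f1 (a s) (b s))" "continuous_on S (\<lambda>s. f2 (a s) (b s))"
  by (rule continuous_on_curried_compose[OF _ assms(2-4)]; use assms(1) in \<open>simp add: has_C1_def\<close>)+

lemma has_C1_cont:
  assumes "has_C1 J f f1 f2" "continuous_on S a" "continuous_on S b" "\<And>s. s \<in> S \<Longrightarrow> a s \<in> J"
  shows "continuous_on S (\<lambda>s. f (a s) (b s))"
proof -
  have "continuous_on (J \<times> UNIV) (\<lambda>p. f (fst p) (snd p))"
    by (rule has_derivative_continuous_on[where
          f' = "\<lambda>p d. f1 (fst p) (snd p) * fst d + f2 (fst p) (snd p) * snd d"])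
      (use assms(1) in \<open>auto simp: has_C1_def\<close>)
  then show ?thesis
    by (rule continuous_on_curried_compose[OF _ assms(2-4)])
qed

lemma has_C1_curve:
  assumes f: "has_C1 J f f1 f2" and s: "s \<in> S" and im: "\<And>s. s \<in> S \<Longrightarrow> a s \<in> J"
    and a: "(a has_real_derivative a') (at s within S)"
    and b: "(b has_real_derivative b') (at s within S)"
    and D: "f1 (a s) (b s) * a' + f2 (a s) (b s) * b' = D"
  shows "((\<lambda>s. f (a s) (b s)) has_real_derivative D) (at s within S)"
proof -
  have "((\<lambda>s. (a s, b s)) has_derivative (\<lambda>h. (a' * h, b' * h))) (at s within S)"
    using a b by (intro has_derivative_Pair) (auto simp: has_field_derivative_def)
  moreover have "((\<lambda>p. f (fst p) (snd p)) has_derivative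
      (\<lambda>d. f1 (a s) (b s) * fst d + f2 (a s) (b s) * snd d))
        (at (a s, b s) within (\<lambda>s. (a s, b s)) ` S)"
    by (rule has_derivative_subset[where s = "J \<times> UNIV"])
      (use f im[OF s] im in \<open>auto simp: has_C1_def\<close>)
  ultimately have "((\<lambda>s. f (fst (a s, b s)) (snd (a s, b s))) has_derivative
     (\<lambda>h. f1 (a s) (b s) * fst (a' * h, b' * h) + f2 (a s) (b s) * snd (a' * h, b' * h))) (at s within S)"
    by (rule has_derivative_in_compose)
  then have "((\<lambda>s. f (a s) (b s)) has_derivative
     (\<lambda>h. f1 (a s) (b s) * (a' * h) + f2 (a s) (b s) * (b' * h))) (at s within S)"
    by (simp only: fst_conv snd_conv)
  then show ?thesis
    unfolding has_field_derivative_def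
    by (rule has_derivative_eq_rhs) (simp add: D[symmetric] algebra_simps fun_eq_iff)
qed

lemma has_C1_D1:
  assumes f: "has_C1 J f f1 f2" and t: "t \<in> J"
  shows "((\<lambda>s. f s x) has_real_derivative f1 t x) (at t within J)"
  by (rule has_C1_curve[OF f t, where a' = 1 and b' = 0]) (auto intro: DERIV_ident)

lemma has_C1_D2:
  assumes f: "has_C1 J f f1 f2" and t: "t \<in> J"
  shows "(f t has_real_derivative f2 t x) (at x)"
  by (rule has_C1_curve[OF f UNIV_I, where a = "\<lambda>_. t" and a' = 0 and b' = 1])
    (auto simp: t intro: DERIV_ident)

lemma has_C1_compose:
  assumes f: "has_C1 J f f1 f2" and a: "has_C1 I a a1 a2" and b: "has_C1 I b b1 b2"
    and im: "\<And>t x. t \<in> I \<Longrightarrow> a t x \<in> J"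
  shows "has_C1 I (\<lambda>t x. f (a t x) (b t x))
    (\<lambda>t x. f1 (a t x) (b t x) * a1 t x + f2 (a t x) (b t x) * b1 t x)
    (\<lambda>t x. f1 (a t x) (b t x) * a2 t x + f2 (a t x) (b t x) * b2 t x)"
proof (rule has_C1I)
  let ?S = "I \<times> (UNIV :: real set)"
  have id: "continuous_on ?S fst" "continuous_on ?S snd"
    by (auto intro: continuous_intros)
  have mem: "fst p \<in> I" "a (fst p) (snd p) \<in> J" if "p \<in> ?S" for p
    using that im by auto
  note ca = has_C1_cont[OF a id mem(1)] has_C1_cont_partial[OF a id mem(1)]
  note cb = has_C1_cont[OF b id mem(1)] has_C1_cont_partial[OF b id mem(1)]
  note cf = has_C1_cont_partial[OF f ca(1) cb(1) mem(2)]
  show "continuous_on ?S (\<lambda>p. f1 (a (fst p) (snd p)) (b (fst p) (snd p)) * a1 (fst p) (snd p)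
      + f2 (a (fst p) (snd p)) (b (fst p) (snd p)) * b1 (fst p) (snd p))"
    "continuous_on ?S (\<lambda>p. f1 (a (fst p) (snd p)) (b (fst p) (snd p)) * a2 (fst p) (snd p)
      + f2 (a (fst p) (snd p)) (b (fst p) (snd p)) * b2 (fst p) (snd p))"
    by (intro continuous_on_add continuous_on_mult ca cb cf; assumption)+
  show "((\<lambda>s. f (a s x) (b s x)) has_real_derivative
     f1 (a t x) (b t x) * a1 t x + f2 (a t x) (b t x) * b1 t x) (at t within I)" if "t \<in> I" for t x
    by (rule has_C1_curve[OF f that _ has_C1_D1[OF a that] has_C1_D1[OF b that] refl]) (rule im)
  show "((\<lambda>x. f (a t x) (b t x)) has_real_derivative
     f1 (a t x) (b t x) * a2 t x + f2 (a t x) (b t x) * b2 t x) (at x)" if "t \<in> I" for t x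
    by (rule has_C1_curve[OF f UNIV_I _ has_C1_D2[OF a that] has_C1_D2[OF b that] refl]) (rule im[OF that])
qed

lemma has_C1_imp_C1_spacetime: "has_C1 J f f1 f2 \<Longrightarrow> C1_spacetime J f"
  unfolding C1_spacetime_def
  by (rule exI[of _ f1], rule exI[of _ f2])
    (use has_C1_D1 has_C1_D2 in \<open>auto simp: split_beta has_C1_def\<close>)

lemma C1_spacetime_imp_has_C1:
  assumes "C1_spacetime J f"
  obtains f1 f2 where "has_C1 J f f1 f2"
proof -
  from assms obtain ft fx where "\<forall>t\<in>J. \<forall>x. ((\<lambda>s. f s x) has_real_derivative ft t x) (at t within J)"
    "\<forall>t\<in>J. \<forall>x. (f t has_real_derivative fx t x) (at x)"
    "continuous_on (J \<times> UNIV) (\<lambda>(t, x). ft t x)" "continuous_on (J \<times> UNIV) (\<lambda>(t, x). fx t x)"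
    unfolding C1_spacetime_def by blast
  then have "has_C1 J f ft fx"
    by (intro has_C1I) (auto simp: case_prod_unfold)
  then show thesis by (rule that)
qed

lemma has_C1_fst: "has_C1 J (\<lambda>t x. t) (\<lambda>t x. 1) (\<lambda>t x. 0)"
  and has_C1_snd: "has_C1 J (\<lambda>t x. x) (\<lambda>t x. 0) (\<lambda>t x. 1)"
  by (auto simp: has_C1_def intro!: derivative_eq_intros continuous_intros)

lemma has_C1_cong:
  assumes "has_C1 J f f1 f2" "\<And>t x. t \<in> J \<Longrightarrow> f1 t x = g1 t x" "\<And>t x. t \<in> J \<Longrightarrow> f2 t x = g2 t x"
  shows "has_C1 J f g1 g2"
proof -
  have "continuous_on (J \<times> UNIV) (\<lambda>p. g1 (fst p) (snd p)) = continuous_on (J \<times> UNIV) (\<lambda>p. f1 (fst p) (snd p))"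
    "continuous_on (J \<times> UNIV) (\<lambda>p. g2 (fst p) (snd p)) = continuous_on (J \<times> UNIV) (\<lambda>p. f2 (fst p) (snd p))"
    by (auto intro!: continuous_on_cong simp: assms)
  then show ?thesis using assms by (simp add: has_C1_def)
qed

lemma has_C1_chain:
  assumes f: "has_C1 J f f1 f2" and \<phi>: "\<And>x. (\<phi> has_real_derivative \<phi>' x) (at x)"
    and c: "continuous_on UNIV \<phi>'"
  shows "has_C1 J (\<lambda>t x. \<phi> (f t x)) (\<lambda>t x. \<phi>' (f t x) * f1 t x) (\<lambda>t x. \<phi>' (f t x) * f2 t x)"
proof (rule has_C1I)
  have c': "continuous_on (J \<times> UNIV) (\<lambda>p. \<phi>' (f (fst p) (snd p)))"
    by (intro continuous_on_compose2[OF c] has_C1_cont[OF f] continuous_intros) auto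
  show "continuous_on (J \<times> UNIV) (\<lambda>p. \<phi>' (f (fst p) (snd p)) * f1 (fst p) (snd p))"
    "continuous_on (J \<times> UNIV) (\<lambda>p. \<phi>' (f (fst p) (snd p)) * f2 (fst p) (snd p))"
    using f by (auto intro!: continuous_on_mult c' simp: has_C1_def)
  fix t x assume t: "t \<in> J"
  show "((\<lambda>s. \<phi> (f s x)) has_real_derivative \<phi>' (f t x) * f1 t x) (at t within J)"
    by (rule DERIV_chain2[OF \<phi> has_C1_D1[OF f t]])
  show "((\<lambda>x. \<phi> (f t x)) has_real_derivative \<phi>' (f t x) * f2 t x) (at x)"
    by (rule DERIV_chain2[OF \<phi> has_C1_D2[OF f t]])
qed

lemma has_C1_lincomb:
  assumes f: "has_C1 J f f1 f2" and g: "has_C1 J g g1 g2"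
  shows "has_C1 J (\<lambda>t x. k * f t x + l * g t x) (\<lambda>t x. k * f1 t x + l * g1 t x) (\<lambda>t x. k * f2 t x + l * g2 t x)"
proof (rule has_C1I)
  show "continuous_on (J \<times> UNIV) (\<lambda>p. k * f1 (fst p) (snd p) + l * g1 (fst p) (snd p))"
    "continuous_on (J \<times> UNIV) (\<lambda>p. k * f2 (fst p) (snd p) + l * g2 (fst p) (snd p))"
    using f g by (auto intro!: continuous_on_mult_left continuous_on_add simp: has_C1_def)
  fix t x assume t: "t \<in> J"
  show "((\<lambda>s. k * f s x + l * g s x) has_real_derivative k * f1 t x + l * g1 t x) (at t within J)"
    by (intro DERIV_add DERIV_cmult has_C1_D1[OF f t] has_C1_D1[OF g t])
  show "((\<lambda>x. k * f t x + l * g t x) has_real_derivative k * f2 t x + l * g2 t x) (at x)"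
    by (intro DERIV_add DERIV_cmult has_C1_D2[OF f t] has_C1_D2[OF g t])
qed

lemma has_C1_mult:
  assumes f: "has_C1 J f f1 f2" and g: "has_C1 J g g1 g2"
  shows "has_C1 J (\<lambda>t x. f t x * g t x) (\<lambda>t x. f1 t x * g t x + g1 t x * f t x) (\<lambda>t x. f2 t x * g t x + g2 t x * f t x)"
proof (rule has_C1I)
  have c: "continuous_on (J \<times> UNIV) (\<lambda>p. f (fst p) (snd p))" "continuous_on (J \<times> UNIV) (\<lambda>p. g (fst p) (snd p))"
    by (rule has_C1_cont[OF f] has_C1_cont[OF g]; auto intro: continuous_intros)+
  show "continuous_on (J \<times> UNIV) (\<lambda>p. f1 (fst p) (snd p) * g (fst p) (snd p) + g1 (fst p) (snd p) * f (fst p) (snd p))"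
    "continuous_on (J \<times> UNIV) (\<lambda>p. f2 (fst p) (snd p) * g (fst p) (snd p) + g2 (fst p) (snd p) * f (fst p) (snd p))"
    using f g by (auto intro!: continuous_on_mult continuous_on_add c simp: has_C1_def)
  fix t x assume t: "t \<in> J"
  show "((\<lambda>s. f s x * g s x) has_real_derivative f1 t x * g t x + g1 t x * f t x) (at t within J)"
    by (rule DERIV_mult[OF has_C1_D1[OF f t] has_C1_D1[OF g t]])
  show "((\<lambda>x. f t x * g t x) has_real_derivative f2 t x * g t x + g2 t x * f t x) (at x)"
    by (rule DERIV_mult[OF has_C1_D2[OF f t] has_C1_D2[OF g t]])
qed

lemma has_C1_divide:
  assumes f: "has_C1 J f f1 f2" and g: "has_C1 J g g1 g2" and nz: "\<And>t x. t \<in> J \<Longrightarrow> g t x \<noteq> 0"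
  shows "has_C1 J (\<lambda>t x. f t x / g t x) (\<lambda>t x. (f1 t x * g t x - f t x * g1 t x) / (g t x * g t x))
     (\<lambda>t x. (f2 t x * g t x - f t x * g2 t x) / (g t x * g t x))"
proof (rule has_C1I)
  have c: "continuous_on (J \<times> UNIV) (\<lambda>p. f (fst p) (snd p))" "continuous_on (J \<times> UNIV) (\<lambda>p. g (fst p) (snd p))"
    by (rule has_C1_cont[OF f] has_C1_cont[OF g]; auto intro: continuous_intros)+
  show "continuous_on (J \<times> UNIV) (\<lambda>p. (f1 (fst p) (snd p) * g (fst p) (snd p) - f (fst p) (snd p) * g1 (fst p) (snd p)) / (g (fst p) (snd p) * g (fst p) (snd p)))"
    "continuous_on (J \<times> UNIV) (\<lambda>p. (f2 (fst p) (snd p) * g (fst p) (snd p) - f (fst p) (snd p) * g2 (fst p) (snd p)) / (g (fst p) (snd p) * g (fst p) (snd p)))"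
    using f g nz by (auto intro!: continuous_on_divide continuous_on_mult continuous_on_diff c simp: has_C1_def)
  fix t x assume t: "t \<in> J"
  show "((\<lambda>s. f s x / g s x) has_real_derivative (f1 t x * g t x - f t x * g1 t x) / (g t x * g t x)) (at t within J)"
    by (rule DERIV_divide[OF has_C1_D1[OF f t] has_C1_D1[OF g t] nz[OF t]])
  show "((\<lambda>x. f t x / g t x) has_real_derivative (f2 t x * g t x - f t x * g2 t x) / (g t x * g t x)) (at x)"
    by (rule DERIV_divide[OF has_C1_D2[OF f t] has_C1_D2[OF g t] nz[OF t]])
qed

text \<open>An implicit function theorem, global in space and valid up to the boundary of
  \<open>J\<close>; strict monotonicity in x replaces openness of the domain. The general right-hand
  side \<open>k\<close> serves three inversions: for a meeting time, for a foot, and for a particle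
  path.\<close>

lemma has_C1_parametric_inverse:
  assumes f: "has_C1 J f f1 f2" and pos: "\<And>t x. t \<in> J \<Longrightarrow> f2 t x > 0"
    and k: "has_C1 J k k1 k2" and eq: "\<And>t v. t \<in> J \<Longrightarrow> f t (g t v) = k t v"
  shows "has_C1 J g (\<lambda>t v. (k1 t v - f1 t (g t v)) / f2 t (g t v)) (\<lambda>t v. k2 t v / f2 t (g t v))"
proof -
  define F where "F p = (fst p, f (fst p) (snd p))" for p
  define h where "h t w = (THE x. f t x = w)" for t w
  let ?S = "J \<times> (UNIV :: real set)"
  define G where "G q = (fst q, h (fst q) (snd q))" for q
  have mono: "f t x < f t y" if "t \<in> J" "x < y" for t x y
    using DERIV_pos_imp_increasing[OF \<open>x < y\<close>] has_C1_D2[OF f \<open>t \<in> J\<close>] pos[OF \<open>t \<in> J\<close>] by blast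
  have le: "x < y" if "t \<in> J" "f t x < f t y" for t x y
    using mono[of t y x] that by (cases x y rule: linorder_cases) auto
  have h: "h t (f t x) = x" if "t \<in> J" for t x
    unfolding h_def using mono[OF that] by (intro the_equality) (auto, metis less_irrefl linorder_neqE_linordered_idom)
  have GF: "G (F p) = p" if "p \<in> ?S" for p
    using that by (auto simp: G_def F_def h)
  have fcont: "continuous_on J (\<lambda>t. f t x)" for x
    by (rule has_C1_cont[OF f]) (simp_all add: continuous_on_id continuous_on_const)
  have G_cont: "continuous (at (F (t, x)) within F ` ?S) G" if t: "t \<in> J" for t x
  proof -
    \<comment> \<open>By monotonicity, comparing the inverse with a level \<open>l\<close> means
      comparing \<open>f t l\<close> with the target value. Continuity of \<open>f\<close> in
      \<open>t\<close> at fixed \<open>l\<close> therefore suffices for continuity of the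
      inverse.\<close>
    have ev: "((\<lambda>q. f (fst q) l - snd q) \<longlongrightarrow> f t l - f t x) (at (F (t, x)) within F ` ?S)" for l
    proof -
      have "continuous_on (F ` ?S) (\<lambda>q. f (fst q) l - snd q)"
        by (intro continuous_intros continuous_on_compose2[OF fcont]) (auto simp: F_def)
      then have "((\<lambda>q. f (fst q) l - snd q) \<longlongrightarrow> f (fst (F (t, x))) l - snd (F (t, x)))
          (at (F (t, x)) within F ` ?S)"
        using t unfolding continuous_on_def by blast
      then show ?thesis by (simp add: F_def)
    qed
    have "((\<lambda>q. h (fst q) (snd q)) \<longlongrightarrow> x) (at (F (t, x)) within F ` ?S)"
    proof (rule order_tendstoI)
      fix l assume "l < x"
      have "eventually (\<lambda>q. f (fst q) l - snd q < 0) (at (F (t, x)) within F ` ?S)"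
        by (rule order_tendstoD(2)[OF ev]) (use mono[OF t \<open>l < x\<close>] in simp)
      moreover have "eventually (\<lambda>q. q \<in> F ` ?S) (at (F (t, x)) within F ` ?S)"
        by (simp add: eventually_at_topological) blast
      ultimately show "eventually (\<lambda>q. l < h (fst q) (snd q)) (at (F (t, x)) within F ` ?S)"
        by eventually_elim (auto simp: F_def h intro: le)
    next
      fix l assume "x < l"
      have "eventually (\<lambda>q. f (fst q) l - snd q > 0) (at (F (t, x)) within F ` ?S)"
        by (rule order_tendstoD(1)[OF ev]) (use mono[OF t \<open>x < l\<close>] in simp)
      moreover have "eventually (\<lambda>q. q \<in> F ` ?S) (at (F (t, x)) within F ` ?S)"
        by (simp add: eventually_at_topological) blast
      ultimately show "eventually (\<lambda>q. h (fst q) (snd q) < l) (at (F (t, x)) within F ` ?S)"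
        by eventually_elim (auto simp: F_def h intro: le)
    qed
    then show ?thesis
      unfolding G_def continuous_within
      by (intro tendsto_Pair tendsto_intros) (simp_all add: F_def h t)
  qed
  have g: "g t v = snd (G (t, k t v))" if "t \<in> J" for t v
    using h[OF that, of "g t v"] eq[OF that, of v] by (simp add: G_def)
  have G_der: "(G has_derivative (\<lambda>d. (fst d, (snd d - f1 t x * fst d) / f2 t x))) (at (F (t, x)) within F ` ?S)"
    if t: "t \<in> J" for t x
  proof (rule has_derivative_inverse_within[OF _ G_cont[OF t]])
    show "(F has_derivative (\<lambda>d. (fst d, f1 t x * fst d + f2 t x * snd d))) (at (t, x) within ?S)"
      unfolding F_def using f t by (auto intro!: derivative_intros simp: has_C1_def)
    show "linear (\<lambda>d. (fst d, (snd d - f1 t x * fst d) / f2 t x))"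
      by (rule linearI) (auto simp: field_simps add_divide_distrib diff_divide_distrib)
    show "(\<lambda>d. (fst d, (snd d - f1 t x * fst d) / f2 t x)) \<circ> (\<lambda>d. (fst d, f1 t x * fst d + f2 t x * snd d)) = id"
      using pos[OF t, of x] by (auto simp: fun_eq_iff)
  qed (use t GF in auto)
  have K: "(t, k t v) = F (t, g t v)" if "t \<in> J" for t v
    using eq[OF that] by (simp add: F_def)
  have g_der: "((\<lambda>p. g (fst p) (snd p)) has_derivative
     (\<lambda>d. (k1 t v - f1 t (g t v)) / f2 t (g t v) * fst d + k2 t v / f2 t (g t v) * snd d)) (at (t, v) within ?S)"
    if t: "t \<in> J" for t v
  proof -
    have k': "((\<lambda>p. (fst p, k (fst p) (snd p))) has_derivative
        (\<lambda>d. (fst d, k1 t v * fst d + k2 t v * snd d))) (at (t, v) within ?S)"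
      using k t by (auto intro!: derivative_intros simp: has_C1_def)
    have im: "(\<lambda>p. (fst p, k (fst p) (snd p))) ` ?S \<subseteq> F ` ?S"
      using K by auto
    have "(G has_derivative (\<lambda>d. (fst d, (snd d - f1 t (g t v) * fst d) / f2 t (g t v))))
       (at (fst (t, v), k (fst (t, v)) (snd (t, v))) within (\<lambda>p. (fst p, k (fst p) (snd p))) ` ?S)"
      using has_derivative_subset[OF G_der[OF t] im] K[OF t] by simp
    from has_derivative_snd[OF has_derivative_in_compose[OF k' this]]
    have "((\<lambda>p. snd (G (fst p, k (fst p) (snd p)))) has_derivative
       (\<lambda>d. (k1 t v * fst d + k2 t v * snd d - f1 t (g t v) * fst d) / f2 t (g t v))) (at (t, v) within ?S)"
      by simp
    then have "((\<lambda>p. g (fst p) (snd p)) has_derivative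
       (\<lambda>d. (k1 t v * fst d + k2 t v * snd d - f1 t (g t v) * fst d) / f2 t (g t v))) (at (t, v) within ?S)"
      by (rule has_derivative_transform[rotated 2]) (use t g in auto)
    then show ?thesis
      by (simp add: algebra_simps add_divide_distrib diff_divide_distrib)
  qed
  have g_cont: "continuous_on ?S (\<lambda>p. g (fst p) (snd p))"
    by (rule has_derivative_continuous_on[where f' = "\<lambda>p d.
          (k1 (fst p) (snd p) - f1 (fst p) (g (fst p) (snd p))) / f2 (fst p) (g (fst p) (snd p)) * fst d
          + k2 (fst p) (snd p) / f2 (fst p) (g (fst p) (snd p)) * snd d"])
      (use g_der in auto)
  have f_cont: "continuous_on ?S (\<lambda>p. f1 (fst p) (g (fst p) (snd p)))"
    "continuous_on ?S (\<lambda>p. f2 (fst p) (g (fst p) (snd p)))"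
    by (rule has_C1_cont_partial[OF f _ g_cont]; auto intro: continuous_intros)+
  have k_cont: "continuous_on ?S (\<lambda>p. k1 (fst p) (snd p))" "continuous_on ?S (\<lambda>p. k2 (fst p) (snd p))"
    using k by (auto simp: has_C1_def)
  have nz: "\<forall>p\<in>?S. f2 (fst p) (g (fst p) (snd p)) \<noteq> 0"
    using pos by (auto simp: less_imp_neq[THEN not_sym])
  show ?thesis
    unfolding has_C1_def
    by (intro conjI ballI allI g_der continuous_intros f_cont k_cont nz) 
qed

section \<open>Integrals with variable endpoints\<close>

lemmas continuous_on_curried_UNIV =
  continuous_on_curried_compose[where J = UNIV, unfolded UNIV_Times_UNIV, OF _ _ _ UNIV_I]

text \<open>For b below a the interval is empty and the integral is 0. This agrees with the
  antiderivative from an earlier base point because \<phi> vanishes there, so the derivative is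
  two-sided even at b = a.\<close>

lemma integral_upper_has_real_derivative:
  fixes \<phi> :: "real \<Rightarrow> real"
  assumes c: "continuous_on UNIV \<phi>" and z: "\<And>z. z \<le> a \<Longrightarrow> \<phi> z = 0"
  shows "((\<lambda>b. integral {a..b} \<phi>) has_real_derivative \<phi> b) (at b)"
proof -
  define p where "p = min a b - 1"
  have eq: "integral {p..x} \<phi> = integral {a..x} \<phi>" if "x > p" for x
  proof (cases "x \<le> a")
    case True
    then have "integral {p..x} \<phi> = integral {p..x} (\<lambda>_. 0)"
      by (intro integral_cong z) auto
    then show ?thesis using True by (cases "x = a") auto
  next
    case False
    have "integral {p..a} \<phi> + integral {a..x} \<phi> = integral {p..x} \<phi>"
      using False by (intro Henstock_Kurzweil_Integration.integral_combine)
        (auto simp: p_def intro!: integrable_continuous_real continuous_on_subset[OF c])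
    moreover have "integral {p..a} \<phi> = integral {p..a} (\<lambda>_. 0)"
      by (intro integral_cong z) auto
    ultimately show ?thesis by simp
  qed
  have "((\<lambda>x. integral {p..x} \<phi>) has_real_derivative \<phi> b) (at b within {p..b + 1})"
    by (rule integral_has_real_derivative) (auto simp: p_def intro: continuous_on_subset[OF c])
  then have "((\<lambda>x. integral {p..x} \<phi>) has_real_derivative \<phi> b) (at b)"
    by (simp add: at_within_Icc_at p_def)
  then show ?thesis
    by (rule has_field_derivative_transform_within_open[where S = "{p<..}"])
      (auto simp: p_def eq[unfolded p_def])
qed

lemma integral_lower_has_real_derivative:
  fixes \<phi> :: "real \<Rightarrow> real"
  assumes c: "continuous_on UNIV \<phi>" and z: "\<And>z. z \<ge> b \<Longrightarrow> \<phi> z = 0"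
  shows "((\<lambda>a. integral {a..b} \<phi>) has_real_derivative - \<phi> a) (at a)"
proof -
  have "integral {a..b} \<phi> = integral {-b..-a} (\<lambda>z. \<phi> (- z))" for a
    by (rule Henstock_Kurzweil_Integration.integral_reflect_real[symmetric])
  moreover have "((\<lambda>a. integral {-b..-a} (\<lambda>z. \<phi> (- z))) has_real_derivative \<phi> (- (- a)) * (- 1)) (at a)"
    by (rule DERIV_chain2[OF integral_upper_has_real_derivative])
      (auto intro!: derivative_eq_intros continuous_intros continuous_on_compose2[OF c] z)
  ultimately show ?thesis by simp
qed

text \<open>Rescaling to the unit interval, with the length truncated at 0, gives a parameter
  integral over a fixed compact set and treats empty intervals in the same formula.\<close>

lemma continuous_on_integral_endpoints:
  fixes h :: "'a::topological_space \<Rightarrow> real \<Rightarrow> real"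
  assumes h: "continuous_on UNIV (\<lambda>q. h (fst q) (snd q))"
    and a: "continuous_on UNIV a" and b: "continuous_on UNIV b"
  shows "continuous_on UNIV (\<lambda>p. integral {a p..b p} (h p))"
proof -
  define d where "d p = max 0 (b p - a p)" for p
  have d: "continuous_on UNIV d" unfolding d_def by (intro continuous_intros a b)
  have hp: "continuous_on UNIV (h p)" for p
    by (intro continuous_on_curried_UNIV[OF h] continuous_intros)
  have "integral {a p..b p} (h p) = integral {0..1} (\<lambda>\<theta>. h p (a p + \<theta> * d p) * d p)" for p
  proof (cases "a p \<le> b p")
    case False
    then show ?thesis by (simp add: d_def)
  next
    case True
    define G where "G x = integral {a p..x} (h p)" for x
    have "((\<lambda>\<theta>. h p (a p + \<theta> * d p) * d p) has_integral (G (a p + 1 * d p) - G (a p + 0 * d p))) {0..1}"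
    proof (rule fundamental_theorem_of_calculus)
      fix \<theta> :: real assume \<theta>: "\<theta> \<in> {0..1}"
      have im: "(\<lambda>\<theta>. a p + \<theta> * d p) ` {0..1} \<subseteq> {a p..b p}"
        using True by (auto simp: d_def max_def mult_nonneg_nonneg)
          (metis add.commute le_diff_eq diff_ge_0_iff_ge mult_left_le_one_le)
      have "(G has_real_derivative h p (a p + \<theta> * d p)) (at (a p + \<theta> * d p) within {a p..b p})"
        unfolding G_def
        by (rule integral_has_real_derivative[OF continuous_on_subset[OF hp]]) (use im \<theta> in blast)+
      then have "(G has_real_derivative h p (a p + \<theta> * d p)) (at (a p + \<theta> * d p) within (\<lambda>\<theta>. a p + \<theta> * d p) ` {0..1})"
        by (rule DERIV_subset) (rule im)
      then have "(G \<circ> (\<lambda>\<theta>. a p + \<theta> * d p) has_real_derivative h p (a p + \<theta> * d p) * d p) (at \<theta> within {0..1})"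
        by (rule DERIV_image_chain) (auto intro!: derivative_eq_intros)
      then have "((\<lambda>\<theta>. G (a p + \<theta> * d p)) has_real_derivative h p (a p + \<theta> * d p) * d p) (at \<theta> within {0..1})"
        by (simp add: o_def)
      then show "((\<lambda>\<theta>. G (a p + \<theta> * d p)) has_vector_derivative h p (a p + \<theta> * d p) * d p) (at \<theta> within {0..1})"
        by (simp add: has_real_derivative_iff_has_vector_derivative)
    qed simp
    moreover have "G (a p + 1 * d p) - G (a p + 0 * d p) = integral {a p..b p} (h p)"
      using True by (simp add: G_def d_def max_def)
    ultimately show ?thesis by (simp only: integral_unique)
  qed
  moreover have "continuous_on UNIV (\<lambda>p. integral (cbox 0 1) (\<lambda>\<theta>. h p (a p + \<theta> * d p) * d p))"
  proof (rule integral_continuous_on_param)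
    have d': "continuous_on (UNIV \<times> cbox 0 1) (\<lambda>q. d (fst q))" "continuous_on (UNIV \<times> cbox 0 1) (\<lambda>q. a (fst q))"
      by (rule continuous_on_compose2[OF d] continuous_on_compose2[OF a]; auto intro: continuous_intros)+
    show "continuous_on (UNIV \<times> cbox 0 1) (\<lambda>(p, \<theta>). h p (a p + \<theta> * d p) * d p)"
      unfolding case_prod_unfold
      by (intro continuous_intros d' continuous_on_curried_UNIV[OF h])
  qed
  ultimately show ?thesis by simp
qed

lemma lborel_integral_indicator_Icc:
  fixes \<phi> :: "real \<Rightarrow> real"
  assumes "continuous_on UNIV \<phi>"
  shows "(LINT x|lborel. indicator {a..b} x * \<phi> x) = integral {a..b} \<phi>"
proof -
  have "set_integrable lborel {a..b} \<phi>"
    unfolding set_integrable_def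
    by (intro borel_integrable_compact continuous_on_subset[OF assms]) auto
  from set_borel_integral_eq_integral(2)[OF this] show ?thesis
    by (simp add: set_lebesgue_integral_def)
qed

lemma integral_triangle_swap:
  fixes h :: "real \<Rightarrow> real \<Rightarrow> real"
  assumes h: "continuous_on UNIV (\<lambda>q. h (fst q) (snd q))"
  shows "integral {a..b} (\<lambda>z. integral {a..z} (\<lambda>s. h s z)) = integral {a..b} (\<lambda>s. integral {s..b} (h s))"
proof -
  define S where "S = {q :: real \<times> real. a \<le> fst q \<and> fst q \<le> snd q \<and> snd q \<le> b}"
  define k where "k s z = indicator S (s, z) * h s z" for s z
  have S: "compact S"
  proof -
    have "closed S"
      unfolding S_def by (intro closed_Collect_conj closed_Collect_le continuous_intros)
    moreover have "S \<subseteq> cbox (a, a) (b, b)"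
      by (auto simp: S_def cbox_Pair_eq)
    ultimately show ?thesis
      by (meson bounded_cbox bounded_subset compact_eq_bounded_closed)
  qed
  have hl: "continuous_on UNIV (h s)" "continuous_on UNIV (\<lambda>s. h s z)" for s z
    by (intro continuous_on_curried_UNIV[OF h] continuous_intros)+
  have I1: "continuous_on UNIV (\<lambda>z. integral {a..z} (\<lambda>s. h s z))"
    by (rule continuous_on_integral_endpoints)
      (auto intro!: continuous_intros continuous_on_curried_UNIV[OF h])
  have I2: "continuous_on UNIV (\<lambda>s. integral {s..b} (h s))"
    by (rule continuous_on_integral_endpoints) (auto intro!: continuous_intros h)
  have "integrable lborel (\<lambda>q. indicator S q *\<^sub>R h (fst q) (snd q))"
    by (intro borel_integrable_compact S continuous_on_subset[OF h]) auto
  then have "integrable (lborel \<Otimes>\<^sub>M lborel) (case_prod k)"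
    by (simp add: lborel_prod k_def case_prod_unfold)
  from lborel_pair.Fubini_integral[OF this]
  have "(LINT z|lborel. LINT s|lborel. k s z) = (LINT s|lborel. LINT z|lborel. k s z)" .
  moreover have "(LINT s|lborel. k s z) = indicator {a..b} z * integral {a..z} (\<lambda>s. h s z)" for z
  proof -
    have "k s z = indicator {a..b} z * (indicator {a..z} s * h s z)" for s
      by (auto simp: k_def S_def indicator_def)
    then show ?thesis by (simp add: lborel_integral_indicator_Icc[OF hl(2)])
  qed
  moreover have "(LINT z|lborel. k s z) = indicator {a..b} s * integral {s..b} (h s)" for s
  proof -
    have "k s z = indicator {a..b} s * (indicator {s..b} z * h s z)" for z
      by (auto simp: k_def S_def indicator_def)
    then show ?thesis by (simp add: lborel_integral_indicator_Icc[OF hl(1)])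
  qed
  ultimately show ?thesis
    by (simp add: lborel_integral_indicator_Icc[OF I1] lborel_integral_indicator_Icc[OF I2])
qed

text \<open>The lower endpoint \<open>a\<close> occurs in both integrals; exchanging the order
  leaves it in the outer one only. Both partial derivatives vanish on the diagonal, so the extension
  by 0 to b < a stays C1.\<close>

lemma has_C1_triangle_integral:
  fixes h :: "real \<Rightarrow> real \<Rightarrow> real"
  assumes h: "continuous_on UNIV (\<lambda>q. h (fst q) (snd q))"
  shows "has_C1 UNIV (\<lambda>a b. integral {a..b} (\<lambda>z. integral {a..z} (\<lambda>s. h s z)))
    (\<lambda>a b. - integral {a..b} (h a)) (\<lambda>a b. integral {a..b} (\<lambda>s. h s b))"
proof (rule has_C1I)
  show "((\<lambda>b. integral {a..b} (\<lambda>z. integral {a..z} (\<lambda>s. h s z))) has_real_derivative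
      integral {a..b} (\<lambda>s. h s b)) (at b)" for a b
    by (rule integral_upper_has_real_derivative[of "\<lambda>z. integral {a..z} (\<lambda>s. h s z)"], rule continuous_on_integral_endpoints)
      (auto intro!: continuous_intros continuous_on_curried_UNIV[OF h]
        simp: le_less)
  show "((\<lambda>a. integral {a..b} (\<lambda>z. integral {a..z} (\<lambda>s. h s z))) has_real_derivative
      - integral {a..b} (h a)) (at a within UNIV)" for a b
    unfolding integral_triangle_swap[OF h]
    by (rule integral_lower_has_real_derivative, rule continuous_on_integral_endpoints)
      (auto intro!: continuous_intros h simp: le_less)
  show "continuous_on (UNIV \<times> UNIV) (\<lambda>p. - integral {fst p..snd p} (h (fst p)))"
    "continuous_on (UNIV \<times> UNIV) (\<lambda>p. integral {fst p..snd p} (\<lambda>s. h s (snd p)))"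
    unfolding UNIV_Times_UNIV
    by (intro continuous_intros continuous_on_integral_endpoints
        continuous_on_curried_UNIV[OF h]
        continuous_on_curried_UNIV[OF h])+
qed

section \<open>A linear Goursat problem\<close>

text \<open>An exponential weight of rate \<open>K\<close> turns an interval of arbitrary length
  into a factor 1 / K, which makes the contraction uniform on the whole plane.\<close>

lemma abs_integral_exp_le:
  fixes \<phi> :: "real \<Rightarrow> real"
  assumes c: "continuous_on UNIV \<phi>" and B: "\<And>z. \<bar>\<phi> z\<bar> \<le> B" and K: "K > 0"
  shows "\<bar>integral {a..b} (\<lambda>z. exp (- K * (b - z)) * \<phi> z)\<bar> \<le> B / K"
    and "\<bar>integral {a..b} (\<lambda>z. exp (- K * (z - a)) * \<phi> z)\<bar> \<le> B / K"
proof -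
  have B0: "0 \<le> B" using B[of 0] by linarith
  have *: "\<bar>integral {a..b} (\<lambda>z. w z * \<phi> z)\<bar> \<le> B / K"
    if w: "continuous_on UNIV w" "\<And>z. 0 \<le> w z" and I: "(w has_integral I) {a..b}" and le: "I \<le> 1 / K" for w I
  proof -
    have "\<bar>integral {a..b} (\<lambda>z. w z * \<phi> z)\<bar> \<le> integral {a..b} (\<lambda>z. B * w z)"
      unfolding real_norm_def[symmetric]
      by (rule integral_norm_bound_integral)
        (auto intro!: integrable_continuous_real continuous_intros continuous_on_subset[OF c] continuous_on_subset[OF w(1)]
          mult_right_mono[OF B w(2)] simp: abs_mult abs_of_nonneg[OF w(2)] mult.commute[of _ "\<bar>\<phi> _\<bar>"])
    also have "\<dots> = B * I" using I by (simp add: integral_unique)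
    also have "\<dots> \<le> B * (1 / K)" by (rule mult_left_mono[OF le B0])
    finally show ?thesis by simp
  qed
  show "\<bar>integral {a..b} (\<lambda>z. exp (- K * (b - z)) * \<phi> z)\<bar> \<le> B / K"
  proof (cases "a \<le> b")
    case True
    have "((\<lambda>z. exp (- K * (b - z))) has_integral (exp (- K * (b - b)) / K - exp (- K * (b - a)) / K)) {a..b}"
      using K by (intro fundamental_theorem_of_calculus True)
        (auto intro!: derivative_eq_intros simp flip: has_real_derivative_iff_has_vector_derivative)
    then show ?thesis
      by (rule *[rotated 2]) (use K in \<open>auto intro!: continuous_intros simp: divide_right_mono\<close>)
  qed (use K B0 in auto)
  show "\<bar>integral {a..b} (\<lambda>z. exp (- K * (z - a)) * \<phi> z)\<bar> \<le> B / K"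
  proof (cases "a \<le> b")
    case True
    have "((\<lambda>z. exp (- K * (z - a))) has_integral (- exp (- K * (b - a)) / K - (- exp (- K * (a - a)) / K))) {a..b}"
      using K by (intro fundamental_theorem_of_calculus True)
        (auto intro!: derivative_eq_intros simp flip: has_real_derivative_iff_has_vector_derivative)
    then show ?thesis
      by (rule *[rotated 2]) (use K in \<open>auto intro!: continuous_intros simp: divide_right_mono\<close>)
  qed (use K B0 in auto)
qed

text \<open>Nonnegativity is not proved afterwards: the nonnegative bounded continuous functions
  form a complete set that the operator preserves because \<open>f\<close> and \<open>g\<close> are
  nonnegative, so the fixed point is found there.\<close>

lemma exists_nonneg_goursat_solution:
  fixes f g :: "real \<Rightarrow> real"
  assumes f: "continuous_on UNIV f" "\<And>x. 0 \<le> f x" "\<And>x. f x \<le> M"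
    and g: "continuous_on UNIV g" "\<And>x. 0 \<le> g x" "\<And>x. g x \<le> M"
  obtains \<gamma> :: "real \<Rightarrow> real \<Rightarrow> real" where "continuous_on UNIV (\<lambda>p. \<gamma> (fst p) (snd p))"
    "\<And>a b. 0 \<le> \<gamma> a b"
    "\<And>a b. \<gamma> a b = g b * (1 + integral {a..b} (\<gamma> a)) + f a * (1 + integral {a..b} (\<lambda>z. \<gamma> z b))"
proof -
  have M: "0 \<le> M" using f(2)[of 0] f(3)[of 0] by linarith
  \<comment> \<open>\<open>\<gamma>\<close> grows at most like \<open>exp (K (b - a))\<close>: after removing this weight the equation is a contraction.\<close>
  define K where "K = 4 * M + 1"
  have K: "K > 0" "2 * M / K \<le> 1 / 2" using M by (auto simp: K_def field_simps)
  \<comment> \<open>Truncated at 0: for b < a the integrals vanish and the equation just reads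
    \<open>g b + f a\<close>, which is bounded without any weight.\<close>
  define d where "d p = max 0 (snd p - fst p)" for p :: "real \<times> real"
  define I1 where "I1 G p = integral {fst p..snd p} (\<lambda>z. exp (- K * (snd p - z)) * G (fst p, z))" for G :: "real \<times> real \<Rightarrow> real" and p
  define I2 where "I2 G p = integral {fst p..snd p} (\<lambda>z. exp (- K * (z - fst p)) * G (z, snd p))" for G :: "real \<times> real \<Rightarrow> real" and p
  define T where "T G p = exp (- K * d p) * (g (snd p) + f (fst p)) + g (snd p) * I1 G p + f (fst p) * I2 G p" for G p
  have fg: "continuous_on UNIV (\<lambda>p::real\<times>real. f (fst p))" "continuous_on UNIV (\<lambda>p::real\<times>real. g (snd p))"
    by (rule continuous_on_compose2[OF f(1)] continuous_on_compose2[OF g(1)]; auto intro: continuous_intros)+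
  have I_cont: "continuous_on UNIV (I1 G)" "continuous_on UNIV (I2 G)" if G: "continuous_on UNIV G" for G
    unfolding I1_def I2_def
    by (intro continuous_on_integral_endpoints continuous_intros continuous_on_compose2[OF G]; simp)+
  have T_cont: "continuous_on UNIV (T G)" if G: "continuous_on UNIV G" for G
    unfolding T_def d_def by (intro continuous_intros fg I_cont G)
  have sl: "continuous_on UNIV (\<lambda>z. G (a, z))" "continuous_on UNIV (\<lambda>z. G (z, b))"
    if G: "continuous_on UNIV G" for G :: "real \<times> real \<Rightarrow> real" and a b
    by (intro continuous_on_compose2[OF G] continuous_intros; simp)+
  have I_bd: "\<bar>I1 G p\<bar> \<le> B / K" "\<bar>I2 G p\<bar> \<le> B / K" if G: "continuous_on UNIV G" and B: "\<And>q. \<bar>G q\<bar> \<le> B" for G B p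
    unfolding I1_def I2_def
    by (rule abs_integral_exp_le[OF sl(1)[OF G] B K(1)] abs_integral_exp_le[OF sl(2)[OF G] B K(1)])+
  have I_bd': "\<bar>g (snd p) * I1 G p + f (fst p) * I2 G p\<bar> \<le> 1/2 * B"
    if G: "continuous_on UNIV G" and B: "\<And>q. \<bar>G q\<bar> \<le> B" for G B p
  proof -
    have B0: "0 \<le> B" using B[of 0] by linarith
    have "\<bar>g (snd p) * I1 G p\<bar> \<le> M * (B / K)"
      unfolding abs_mult using g M I_bd(1)[OF G B] by (intro mult_mono) auto
    moreover have "\<bar>f (fst p) * I2 G p\<bar> \<le> M * (B / K)"
      unfolding abs_mult using f M I_bd(2)[OF G B] by (intro mult_mono) auto
    moreover have "M * (B / K) + M * (B / K) = (2 * M / K) * B" by simp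
    ultimately have "\<bar>g (snd p) * I1 G p + f (fst p) * I2 G p\<bar> \<le> (2 * M / K) * B"
      by linarith
    also have "\<dots> \<le> 1/2 * B" by (rule mult_right_mono[OF K(2) B0])
    finally show ?thesis .
  qed
  have T_bd: "\<bar>T G p\<bar> \<le> 2 * M + 1/2 * B" if G: "continuous_on UNIV G" and B: "\<And>q. \<bar>G q\<bar> \<le> B" for G B p
  proof -
    have e: "exp (- K * d p) \<le> 1" using K by (auto simp: d_def)
    have "\<bar>exp (- K * d p) * (g (snd p) + f (fst p))\<bar> \<le> 1 * (2 * M)"
      unfolding abs_mult using f(2,3)[of "fst p"] g(2,3)[of "snd p"] e M by (intro mult_mono) auto
    then show ?thesis using I_bd'[OF G B, of p] unfolding T_def by linarith
  qed
  have T_bc: "T (apply_bcontfun G) \<in> bcontfun" for G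
  proof -
    obtain B where "\<And>q. \<bar>apply_bcontfun G q\<bar> \<le> B"
      using bounded_apply_bcontfun[of G] by (auto simp: bounded_iff)
    then have "bounded (range (T (apply_bcontfun G)))"
      using T_bd[of "apply_bcontfun G" B] by (auto intro!: boundedI)
    then show ?thesis by (simp add: bcontfun_def T_cont)
  qed
  have app: "apply_bcontfun (Bcontfun (T (apply_bcontfun G))) = T (apply_bcontfun G)" for G
    by (simp add: Bcontfun_inverse T_bc)
  define P where "P = PiC (UNIV :: (real \<times> real) set) (\<lambda>_. {0::real..})"
  have "\<exists>!G\<in>P. Bcontfun (T (apply_bcontfun G)) = G"
  proof (rule Banach_fix[where c = "1/2"])
    show "complete P" unfolding P_def by (simp add: complete_eq_closed closed_PiC)
    have "const_bcontfun 0 \<in> P"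
      by (auto simp: P_def mem_PiC_iff const_bcontfun.rep_eq)
    then show "P \<noteq> {}" by auto
    show "(\<lambda>G. Bcontfun (T (apply_bcontfun G))) ` P \<subseteq> P"
    proof safe
      fix G assume "G \<in> P"
      then have pos: "0 \<le> apply_bcontfun G p" for p by (auto simp: P_def mem_PiC_iff)
      have "0 \<le> I1 (apply_bcontfun G) p" "0 \<le> I2 (apply_bcontfun G) p" for p
        unfolding I1_def I2_def
        by (intro integral_nonneg integrable_continuous_real continuous_intros
            continuous_on_subset[OF sl(1)] continuous_on_subset[OF sl(2)] mult_nonneg_nonneg pos; simp)+
      then have "0 \<le> T (apply_bcontfun G) p" for p
        unfolding T_def by (intro add_nonneg_nonneg mult_nonneg_nonneg f g) auto
      then show "Bcontfun (T (apply_bcontfun G)) \<in> P"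
        by (simp add: P_def mem_PiC_iff app)
    qed
    fix G H :: "(real \<times> real) \<Rightarrow>\<^sub>C real"
    show "dist (Bcontfun (T (apply_bcontfun G))) (Bcontfun (T (apply_bcontfun H))) \<le> 1/2 * dist G H"
    proof (rule dist_bound, unfold app)
      fix p
      let ?D = "\<lambda>q. apply_bcontfun G q - apply_bcontfun H q"
      have D: "continuous_on UNIV ?D" "\<bar>?D q\<bar> \<le> dist G H" for q
        using dist_bounded[where f = G and g = H and x = q] by (auto intro!: continuous_intros simp: dist_real_def)
      have "I1 (apply_bcontfun G) p - I1 (apply_bcontfun H) p = I1 ?D p"
        "I2 (apply_bcontfun G) p - I2 (apply_bcontfun H) p = I2 ?D p"
        unfolding I1_def I2_def right_diff_distrib
        by (rule integral_diff[symmetric]; intro integrable_continuous_real continuous_intros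
            continuous_on_subset[OF sl(1)] continuous_on_subset[OF sl(2)]; simp)+
      then have "T (apply_bcontfun G) p - T (apply_bcontfun H) p = g (snd p) * I1 ?D p + f (fst p) * I2 ?D p"
        by (simp add: T_def algebra_simps flip: right_diff_distrib)
      then show "dist (T (apply_bcontfun G) p) (T (apply_bcontfun H) p) \<le> 1/2 * dist G H"
        unfolding dist_real_def using I_bd'[OF D] by simp
    qed
  qed auto
  then obtain G where "G \<in> P" and "Bcontfun (T (apply_bcontfun G)) = G" by auto
  then have fix_G: "T (apply_bcontfun G) p = apply_bcontfun G p" and pos: "0 \<le> apply_bcontfun G p" for p
    using app[of G] by (auto simp: P_def mem_PiC_iff)
  define \<gamma> where "\<gamma> a b = exp (K * d (a, b)) * apply_bcontfun G (a, b)" for a b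
  show thesis
  proof (rule that[of \<gamma>])
    show "continuous_on UNIV (\<lambda>p. \<gamma> (fst p) (snd p))"
      unfolding \<gamma>_def d_def by (auto intro!: continuous_intros)
    show "0 \<le> \<gamma> a b" for a b by (simp add: \<gamma>_def pos)
    fix a b
    have "exp (K * d (a, b)) * I1 (apply_bcontfun G) (a, b) = integral {a..b} (\<gamma> a)"
      unfolding I1_def integral_mult_right[symmetric] fst_conv snd_conv
      by (rule integral_cong) (auto simp: \<gamma>_def d_def algebra_simps simp flip: exp_add)
    moreover have "exp (K * d (a, b)) * I2 (apply_bcontfun G) (a, b) = integral {a..b} (\<lambda>z. \<gamma> z b)"
      unfolding I2_def integral_mult_right[symmetric] fst_conv snd_conv
      by (rule integral_cong) (auto simp: \<gamma>_def d_def algebra_simps simp flip: exp_add)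
    moreover have "\<gamma> a b = exp (K * d (a, b)) * T (apply_bcontfun G) (a, b)"
      by (simp add: \<gamma>_def fix_G)
    then have "\<gamma> a b = (g b + f a) + g b * (exp (K * d (a, b)) * I1 (apply_bcontfun G) (a, b))
       + f a * (exp (K * d (a, b)) * I2 (apply_bcontfun G) (a, b))"
      using exp_minus_inverse[of "K * d (a, b)"] unfolding T_def fst_conv snd_conv mult_minus_left by algebra
    ultimately show "\<gamma> a b = g b * (1 + integral {a..b} (\<gamma> a)) + f a * (1 + integral {a..b} (\<lambda>z. \<gamma> z b))"
      by (simp add: algebra_simps)
  qed
qed

section \<open>Characteristic coordinates\<close>

lemma surj_of_deriv_ge_one:
  fixes f :: "real \<Rightarrow> real"
  assumes d: "\<And>x. (f has_real_derivative f' x) (at x)" and ge: "\<And>x. f' x \<ge> 1"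
  shows "surj f"
proof -
  have g: "x \<le> y \<Longrightarrow> f x - x \<le> f y - y" for x y
    by (rule DERIV_nonneg_imp_nondecreasing[where f = "\<lambda>x. f x - x"])
      (auto intro!: exI[of _ "f' _ - 1"] derivative_eq_intros d simp: ge)
  have c: "continuous_on A f" for A
    by (meson DERIV_continuous_on d has_field_derivative_at_within)
  have "\<exists>x. f x = y" for y
  proof -
    \<comment> \<open>Since f minus the identity is nondecreasing, moving from 0 by the missing
      amount \<open>y - f 0\<close> reaches or passes the value \<open>y\<close>.\<close>
    define L where "L = min 0 (y - f 0)"
    define U where "U = max 0 (y - f 0)"
    have "f L \<le> y" "y \<le> f U" "L \<le> U"
      using g[of L 0] g[of 0 U] by (auto simp: L_def U_def)
    then show ?thesis using IVT'[OF _ _ _ c] by blast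
  qed
  then show ?thesis by (metis surjI)
qed

text \<open>\<open>\<gamma>_eq\<close> is the Goursat equation for \<gamma> = - T_ab with T = 2 c
  tau. The two brackets are - T_a and T_b, and their constant 1 is the value on the
  diagonal.\<close>

locale rarefactive_data =
  fixes c M :: real and r s r' s' :: "real \<Rightarrow> real" and \<gamma> :: "real \<Rightarrow> real \<Rightarrow> real"
  assumes c: "c > 0"
    and r: "\<And>x. (r has_real_derivative r' x) (at x)" and r'_cont: "continuous_on UNIV r'"
    and r'_ge: "\<And>x. 0 \<le> r' x" and r'_le: "\<And>x. r' x \<le> M"
    and s: "\<And>x. (s has_real_derivative s' x) (at x)" and s'_cont: "continuous_on UNIV s'"
    and s'_ge: "\<And>x. 0 \<le> s' x" and s'_le: "\<And>x. s' x \<le> M"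
    and \<gamma>_cont: "continuous_on UNIV (\<lambda>p. \<gamma> (fst p) (snd p))"
    and \<gamma>_ge: "\<And>a b. 0 \<le> \<gamma> a b"
    and \<gamma>_eq: "\<And>a b. \<gamma> a b = s' b / (4 * c) * (1 + integral {a..b} (\<gamma> a))
      + r' a / (4 * c) * (1 + integral {a..b} (\<lambda>z. \<gamma> z b))"
begin

text \<open>\<open>T / (2 c)\<close> and \<open>pos\<close> are the time and the position at which the forward characteristic from \<open>a\<close>
  meets the backward one from \<open>b\<close>. Only \<open>a \<le> b\<close> is meaningful; for \<open>b < a\<close> the integrals are \<open>0\<close>,
  which extends everything to the plane in a \<open>C\<^sup>1\<close> way and avoids derivatives at the boundary \<open>a = b\<close>.\<close>

definition \<alpha> where "\<alpha> a b = 1 + integral {a..b} (\<lambda>z. \<gamma> z b)"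
definition \<beta> where "\<beta> a b = 1 + integral {a..b} (\<gamma> a)"
definition T where "T a b = (b - a) + integral {a..b} (\<lambda>z. integral {a..z} (\<lambda>s. \<gamma> s z))"
text \<open>Integrating x_b = (v + c) tau_b by parts in b gives x = a + (v + c) tau minus the
  integral of s' tau / 2. \<open>Q\<close> is this last integral, with \<open>T a z\<close> written
  as the integral of \<open>\<beta> \<sigma> z\<close> over \<sigma> so that
  \<open>has_C1_triangle_integral\<close> yields both partial derivatives.\<close>

definition Q where "Q a b = integral {a..b} (\<lambda>z. integral {a..z} (\<lambda>\<sigma>. s' z / (4 * c) * \<beta> \<sigma> z))"
definition vel where "vel a b = (r a + s b) / 2"
definition pos where "pos a b = (vel a b + c) * (T a b / (2 * c)) + a - Q a b"

lemma \<gamma>_slice: "continuous_on UNIV (\<gamma> a)" "continuous_on UNIV (\<lambda>z. \<gamma> z b)"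
  by (intro continuous_on_curried_UNIV[OF \<gamma>_cont] continuous_intros)+

lemma \<alpha>_cont: "continuous_on UNIV (\<lambda>p. \<alpha> (fst p) (snd p))"
  and \<beta>_cont: "continuous_on UNIV (\<lambda>p. \<beta> (fst p) (snd p))"
  unfolding \<alpha>_def \<beta>_def
  by (intro continuous_on_integral_endpoints continuous_on_curried_UNIV[OF \<gamma>_cont] continuous_intros)+

lemma \<alpha>_ge: "\<alpha> a b \<ge> 1" and \<beta>_ge: "\<beta> a b \<ge> 1"
  unfolding \<alpha>_def \<beta>_def
  by (simp, intro integral_nonneg integrable_continuous_real continuous_on_subset[OF \<gamma>_slice(1)]
      continuous_on_subset[OF \<gamma>_slice(2)] \<gamma>_ge; simp)+

lemma \<alpha>_pos [simp]: "\<alpha> a b > 0" "\<alpha> a b \<noteq> 0" and \<beta>_pos [simp]: "\<beta> a b > 0" "\<beta> a b \<noteq> 0"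
  using \<alpha>_ge[of a b] \<beta>_ge[of a b] by auto

lemma s'_cont_compose: "continuous_on S f \<Longrightarrow> continuous_on S (\<lambda>x. s' (f x))"
  and r'_cont_compose: "continuous_on S f \<Longrightarrow> continuous_on S (\<lambda>x. r' (f x))"
  by (rule continuous_on_compose2[OF s'_cont] continuous_on_compose2[OF r'_cont]; simp)+

lemma r_cont_compose: "continuous_on S f \<Longrightarrow> continuous_on S (\<lambda>x. r (f x))"
  and s_cont_compose: "continuous_on S f \<Longrightarrow> continuous_on S (\<lambda>x. s (f x))"
  by (rule continuous_on_compose2[OF DERIV_continuous_on[where s = UNIV, OF r]]
      continuous_on_compose2[OF DERIV_continuous_on[where s = UNIV, OF s]]; simp)+

lemma T_C1: "has_C1 UNIV T (\<lambda>a b. - \<beta> a b) \<alpha>"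
proof (rule has_C1I)
  note J = has_C1_triangle_integral[OF \<gamma>_cont]
  show "((\<lambda>a. T a b) has_real_derivative - \<beta> a b) (at a within UNIV)" for a b
    unfolding T_def \<beta>_def using has_C1_D1[OF J] by (auto intro!: derivative_eq_intros)
  show "(T a has_real_derivative \<alpha> a b) (at b)" for a b
    unfolding T_def[abs_def] \<alpha>_def using has_C1_D2[OF J] by (auto intro!: derivative_eq_intros)
qed (auto intro!: continuous_intros \<alpha>_cont \<beta>_cont)

lemma Q_integrand_cont: "continuous_on UNIV (\<lambda>q. s' (snd q) / (4 * c) * \<beta> (fst q) (snd q))"
  using c by (intro continuous_intros s'_cont_compose \<beta>_cont) auto

lemmas Q_C1 = has_C1_triangle_integral[OF Q_integrand_cont, folded Q_def]

lemma T_diag: "b \<le> a \<Longrightarrow> T a b = b - a"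
  by (auto simp: T_def le_less)

lemma \<alpha>\<beta>_slice: "continuous_on UNIV (\<alpha> a)" "continuous_on UNIV (\<lambda>z. \<beta> z b)" "continuous_on UNIV (\<beta> a)"
  by (intro continuous_on_curried_UNIV[OF \<alpha>_cont] continuous_on_curried_UNIV[OF \<beta>_cont] continuous_intros)+

lemma integral_\<beta>: "a \<le> b \<Longrightarrow> integral {a..b} (\<lambda>z. \<beta> z b) = T a b"
  and integral_\<alpha>: "a \<le> b \<Longrightarrow> integral {a..b} (\<alpha> a) = T a b"
proof -
  assume ab: "a \<le> b"
  have "((\<lambda>z. \<beta> z b) has_integral (- T b b - (- T a b))) {a..b}"
    by (intro fundamental_theorem_of_calculus ab)
      (auto intro!: derivative_eq_intros has_field_derivative_at_within[OF has_C1_D1[OF T_C1]]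
        simp flip: has_real_derivative_iff_has_vector_derivative)
  then show "integral {a..b} (\<lambda>z. \<beta> z b) = T a b" by (simp add: integral_unique T_diag)
  have "(\<alpha> a has_integral (T a b - T a a)) {a..b}"
    by (intro fundamental_theorem_of_calculus ab)
      (auto intro!: derivative_eq_intros has_field_derivative_at_within[OF has_C1_D2[OF T_C1]]
        simp flip: has_real_derivative_iff_has_vector_derivative)
  then show "integral {a..b} (\<alpha> a) = T a b" by (simp add: integral_unique T_diag)
qed

text \<open>The equation for \<gamma> integrated in b at fixed a; as \<alpha> = T_b and T is 0 on
  the diagonal, the term with \<alpha> integrates to T.\<close>

lemma \<beta>_eq:
  assumes "a \<le> b"
  shows "\<beta> a b = 1 + integral {a..b} (\<lambda>z. s' z / (4 * c) * \<beta> a z) + r' a / (4 * c) * T a b"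
proof -
  have "integral {a..b} (\<gamma> a) = integral {a..b} (\<lambda>z. s' z / (4 * c) * \<beta> a z + r' a / (4 * c) * \<alpha> a z)"
    using \<gamma>_eq[of a] by (intro integral_cong) (simp add: \<alpha>_def \<beta>_def)
  also have "\<dots> = integral {a..b} (\<lambda>z. s' z / (4 * c) * \<beta> a z) + r' a / (4 * c) * integral {a..b} (\<alpha> a)"
    using c by (subst integral_add)
      (auto intro!: integrable_continuous_real continuous_intros s'_cont_compose
        continuous_on_subset[OF \<alpha>\<beta>_slice(1)] continuous_on_subset[OF \<alpha>\<beta>_slice(3)])
  finally show ?thesis by (simp add: \<beta>_def integral_\<alpha>[OF assms])
qed

lemma Q_D2: "a \<le> b \<Longrightarrow> integral {a..b} (\<lambda>z. s' b / (4 * c) * \<beta> z b) = s' b / (4 * c) * T a b"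
  by (simp add: integral_\<beta>)

lemma pos_C1:
  "has_C1 UNIV pos
    (\<lambda>a b. r' a / 2 * (T a b / (2 * c)) + (vel a b + c) * (- \<beta> a b / (2 * c)) + 1
       + integral {a..b} (\<lambda>z. s' z / (4 * c) * \<beta> a z))
    (\<lambda>a b. s' b / 2 * (T a b / (2 * c)) + (vel a b + c) * (\<alpha> a b / (2 * c))
       - integral {a..b} (\<lambda>z. s' b / (4 * c) * \<beta> z b))"
proof (rule has_C1I)
  have T_cont: "continuous_on (UNIV \<times> UNIV) (\<lambda>p. T (fst p) (snd p))"
    by (rule has_C1_cont[OF T_C1]) (auto intro: continuous_intros)
  have J1': "continuous_on UNIV (\<lambda>p. integral {fst p..snd p} (\<lambda>z. s' z / (4 * c) * \<beta> (fst p) z))"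
    using continuous_on_minus[OF has_C1_cont_partial(1)[OF Q_C1, of UNIV fst snd]]
    by (simp add: continuous_on_fst continuous_on_snd continuous_on_id)
  have J2': "continuous_on UNIV (\<lambda>p. integral {fst p..snd p} (\<lambda>z. s' (snd p) / (4 * c) * \<beta> z (snd p)))"
    by (rule has_C1_cont_partial(2)[OF Q_C1]) (auto intro: continuous_intros)
  show "continuous_on (UNIV \<times> UNIV) (\<lambda>p. r' (fst p) / 2 * (T (fst p) (snd p) / (2 * c))
       + (vel (fst p) (snd p) + c) * (- \<beta> (fst p) (snd p) / (2 * c)) + 1
       + integral {fst p..snd p} (\<lambda>z. s' z / (4 * c) * \<beta> (fst p) z))"
    "continuous_on (UNIV \<times> UNIV) (\<lambda>p. s' (snd p) / 2 * (T (fst p) (snd p) / (2 * c))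
       + (vel (fst p) (snd p) + c) * (\<alpha> (fst p) (snd p) / (2 * c))
       - integral {fst p..snd p} (\<lambda>z. s' (snd p) / (4 * c) * \<beta> z (snd p)))"
    unfolding UNIV_Times_UNIV vel_def using c
    by (intro continuous_intros r'_cont_compose s'_cont_compose r_cont_compose s_cont_compose
        J1' J2' \<alpha>_cont \<beta>_cont T_cont[unfolded UNIV_Times_UNIV]; simp)+
  fix a b
  show "((\<lambda>a. pos a b) has_real_derivative r' a / 2 * (T a b / (2 * c)) + (vel a b + c) * (- \<beta> a b / (2 * c)) + 1
       + integral {a..b} (\<lambda>z. s' z / (4 * c) * \<beta> a z)) (at a within UNIV)"
    unfolding pos_def vel_def using c
    by (auto intro!: derivative_eq_intros r has_C1_D1[OF T_C1] has_C1_D1[OF Q_C1] simp: field_simps)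
  show "(pos a has_real_derivative s' b / 2 * (T a b / (2 * c)) + (vel a b + c) * (\<alpha> a b / (2 * c))
       - integral {a..b} (\<lambda>z. s' b / (4 * c) * \<beta> z b)) (at b)"
    unfolding pos_def[abs_def] vel_def using c
    by (auto intro!: derivative_eq_intros s has_C1_D2[OF T_C1] has_C1_D2[OF Q_C1] simp: field_simps)
qed

text \<open>This is x_a = (v - c) tau_a. Since \<open>pos\<close> was built by integrating along
  forward characteristics, the fact that curves of fixed b are backward characteristics is a genuine
  compatibility condition; here the Goursat equation enters, through
  \<open>\<beta>_eq\<close>.\<close>

lemma pos_D1:
  assumes "a \<le> b"
  shows "r' a / 2 * (T a b / (2 * c)) + (vel a b + c) * (- \<beta> a b / (2 * c)) + 1
       + integral {a..b} (\<lambda>z. s' z / (4 * c) * \<beta> a z) = - (vel a b - c) * \<beta> a b / (2 * c)"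
proof -
  have "1 + integral {a..b} (\<lambda>z. s' z / (4 * c) * \<beta> a z) = \<beta> a b - r' a / (4 * c) * T a b"
    using \<beta>_eq[OF assms] by simp
  then show ?thesis using c by (simp add: field_simps)
qed

lemma pos_D2:
  assumes "a \<le> b"
  shows "s' b / 2 * (T a b / (2 * c)) + (vel a b + c) * (\<alpha> a b / (2 * c))
       - integral {a..b} (\<lambda>z. s' b / (4 * c) * \<beta> z b) = (vel a b + c) * \<alpha> a b / (2 * c)"
  unfolding Q_D2[OF assms] using c by (simp add: field_simps)

section \<open>Forward characteristics as functions of time\<close>

definition hit where "hit a \<tau> = (SOME b. T a b = 2 * c * \<tau>)"

lemma T_strict_mono: "b < b' \<Longrightarrow> T a b < T a b'"
  by (rule DERIV_pos_imp_increasing) (auto intro!: exI[of _ "\<alpha> a _"] has_C1_D2[OF T_C1])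

lemma T_inj: "T a b = T a b' \<Longrightarrow> b = b'"
  using T_strict_mono[of b b' a] T_strict_mono[of b' b a] by (cases b b' rule: linorder_cases) auto

lemma T_hit: "T a (hit a \<tau>) = 2 * c * \<tau>"
proof -
  have "surj (T a)"
    by (rule surj_of_deriv_ge_one[OF has_C1_D2[OF T_C1] \<alpha>_ge]) simp
  then obtain b where "T a b = 2 * c * \<tau>" by (metis surjD)
  then show ?thesis unfolding hit_def by (rule someI)
qed

lemma hit_T: "hit a (T a b / (2 * c)) = b"
  by (rule T_inj[of a]) (use c in \<open>simp add: T_hit\<close>)

lemma hit_ge: "\<tau> \<ge> 0 \<Longrightarrow> a \<le> hit a \<tau>"
  using T_diag[of "hit a \<tau>" a] mult_nonneg_nonneg[of "2 * c" \<tau>] c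
  by (cases "hit a \<tau> < a") (auto simp: T_hit)

lemma hit_0 [simp]: "hit a 0 = a"
  by (rule T_inj[of a]) (simp add: T_hit T_diag)

text \<open>Because \<open>T a\<close> grows at least at unit rate, feet whose characteristics meet
  at time \<tau> are at most 2 c \<tau> apart, the distance for a constant state.\<close>

lemma hit_le: "\<tau> \<ge> 0 \<Longrightarrow> hit a \<tau> \<le> a + 2 * c * \<tau>"
proof -
  assume \<tau>: "\<tau> \<ge> 0"
  have "T a a - a \<le> T a (hit a \<tau>) - hit a \<tau>"
    by (rule DERIV_nonneg_imp_nondecreasing[OF hit_ge[OF \<tau>]])
      (auto intro!: exI[of _ "\<alpha> a _ - 1"] derivative_eq_intros has_C1_D2[OF T_C1] simp: \<alpha>_ge)
  then show ?thesis by (simp add: T_hit T_diag)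
qed

lemma hit_C1: "has_C1 UNIV hit (\<lambda>a \<tau>. \<beta> a (hit a \<tau>) / \<alpha> a (hit a \<tau>)) (\<lambda>a \<tau>. 2 * c / \<alpha> a (hit a \<tau>))"
proof -
  have k: "has_C1 UNIV (\<lambda>a \<tau>. 2 * c * \<tau>) (\<lambda>a \<tau>. 0) (\<lambda>a \<tau>. 2 * c)"
    by (rule has_C1I) (auto intro!: derivative_eq_intros continuous_intros)
  show ?thesis
    using has_C1_parametric_inverse[OF T_C1 _ k T_hit] by simp
qed

definition char_plus where "char_plus \<tau> a = pos a (hit a \<tau>)"

text \<open>At fixed a, dividing x_b by tau_b leaves the speed v + c. At fixed time the derivative
  in a is x_a + x_b \<beta> / \<alpha>, where the terms in v cancel and \<beta> remains. So \<beta>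
  measures the spreading of neighbouring forward characteristics, and \<beta> at least 1 excludes
  focusing.\<close>

lemma char_plus_C1:
  "has_C1 {0..} char_plus (\<lambda>\<tau> a. vel a (hit a \<tau>) + c) (\<lambda>\<tau> a. \<beta> a (hit a \<tau>))"
proof -
  note h = has_C1_compose[where I = "{0..}", OF hit_C1 has_C1_snd has_C1_fst UNIV_I]
  note p = has_C1_compose[where I = "{0..}", OF pos_C1 has_C1_snd h UNIV_I]
  show ?thesis unfolding char_plus_def[abs_def]
  proof (rule has_C1_cong[OF p])
    fix \<tau> a :: real assume "\<tau> \<in> {0..}"
    then have "a \<le> hit a \<tau>" by (simp add: hit_ge)
    note D = pos_D1[OF this] pos_D2[OF this]
    show "(r' a / 2 * (T a (hit a \<tau>) / (2 * c)) + (vel a (hit a \<tau>) + c) * (- \<beta> a (hit a \<tau>) / (2 * c)) + 1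
         + integral {a..hit a \<tau>} (\<lambda>z. s' z / (4 * c) * \<beta> a z)) * 0
       + (s' (hit a \<tau>) / 2 * (T a (hit a \<tau>) / (2 * c)) + (vel a (hit a \<tau>) + c) * (\<alpha> a (hit a \<tau>) / (2 * c))
         - integral {a..hit a \<tau>} (\<lambda>z. s' (hit a \<tau>) / (4 * c) * \<beta> z (hit a \<tau>)))
         * (\<beta> a (hit a \<tau>) / \<alpha> a (hit a \<tau>) * 0 + 2 * c / \<alpha> a (hit a \<tau>) * 1)
       = vel a (hit a \<tau>) + c"
      unfolding D using c by simp
    show "(r' a / 2 * (T a (hit a \<tau>) / (2 * c)) + (vel a (hit a \<tau>) + c) * (- \<beta> a (hit a \<tau>) / (2 * c)) + 1
         + integral {a..hit a \<tau>} (\<lambda>z. s' z / (4 * c) * \<beta> a z)) * 1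
       + (s' (hit a \<tau>) / 2 * (T a (hit a \<tau>) / (2 * c)) + (vel a (hit a \<tau>) + c) * (\<alpha> a (hit a \<tau>) / (2 * c))
         - integral {a..hit a \<tau>} (\<lambda>z. s' (hit a \<tau>) / (4 * c) * \<beta> z (hit a \<tau>)))
         * (\<beta> a (hit a \<tau>) / \<alpha> a (hit a \<tau>) * 1 + 2 * c / \<alpha> a (hit a \<tau>) * 0)
       = \<beta> a (hit a \<tau>)"
      unfolding D using c by (simp add: field_simps)
  qed
qed

end

section \<open>Particle paths\<close>

lemma within_deriv_nonneg_imp_le:
  fixes f :: "real \<Rightarrow> real"
  assumes "a \<le> b" and d: "\<And>x. x \<in> {a..b} \<Longrightarrow> (f has_real_derivative f' x) (at x within {a..b})"
    and "\<And>x. x \<in> {a..b} \<Longrightarrow> f' x \<ge> 0"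
  shows "f a \<le> f b"
proof (rule DERIV_nonneg_imp_increasing_open[OF \<open>a \<le> b\<close>])
  show "continuous_on {a..b} f" by (rule DERIV_continuous_on[OF d])
  fix x assume "a < x" "x < b"
  then show "\<exists>y. (f has_real_derivative y) (at x) \<and> 0 \<le> y"
    using d[of x] assms(3)[of x] by (auto simp: at_within_Icc_at)
qed

text \<open>A potential \<open>N\<close> of the closed form \<open>R dx - F dt\<close>; its level sets are particle paths.\<close>

lemma exists_mass_potential:
  assumes R: "has_C1 {0..} R R1 R2" and F: "has_C1 {0..} F F1 F2"
    and closed: "\<And>t x. t \<ge> 0 \<Longrightarrow> R1 t x + F2 t x = 0"
  obtains N where "has_C1 {0..} N (\<lambda>t x. - F t x) R"
proof -
  \<comment> \<open>\<open>x\<close> times a mean over the unit interval is the integral of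
    \<open>R t\<close> from 0 to \<open>x\<close> for either sign of \<open>x\<close>.
    \<open>P\<close> will compensate for the flux through x = 0.\<close>
  define G where "G t x = x * integral (cbox 0 1) (\<lambda>\<theta>. R t (\<theta> * x))" for t x
  define P where "P t = integral {0..t} (\<lambda>s. F s 0)" for t
  have cR: "continuous_on S (\<lambda>p. R (a p) (b p))" "continuous_on S (\<lambda>p. R1 (a p) (b p))" "continuous_on S (\<lambda>p. R2 (a p) (b p))"
    if "continuous_on S a" "continuous_on S b" "\<And>p. p \<in> S \<Longrightarrow> a p \<ge> 0" for S :: "'b::topological_space set" and a b
    using has_C1_cont[OF R that(1,2)] has_C1_cont_partial[OF R that(1,2)] that(3) by auto
  have cF: "continuous_on S (\<lambda>p. F (a p) (b p))" "continuous_on S (\<lambda>p. F1 (a p) (b p))" "continuous_on S (\<lambda>p. F2 (a p) (b p))"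
    if "continuous_on S a" "continuous_on S b" "\<And>p. p \<in> S \<Longrightarrow> a p \<ge> 0" for S :: "'b::topological_space set" and a b
    using has_C1_cont[OF F that(1,2)] has_C1_cont_partial[OF F that(1,2)] that(3) by auto
  have P: "(P has_real_derivative F t 0) (at t within {0..})" if "t \<ge> 0" for t
  proof -
    have "(P has_real_derivative F t 0) (at t within {0..t + 1})"
      unfolding P_def using that
      by (intro integral_has_real_derivative cF) (auto intro: continuous_intros)
    also have "at t within {0..t + 1} = at t within {0..}"
      by (rule at_within_nhd[where S = "{..<t + 1}"]) auto
    finally show ?thesis .
  qed
  have G2: "(G t has_real_derivative R t x) (at x)" if t: "t \<ge> 0" for t x
  proof -
    have "((\<lambda>x. integral (cbox 0 1) (\<lambda>\<theta>. R t (\<theta> * x))) has_real_derivative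
        integral (cbox 0 1) (\<lambda>\<theta>. R2 t (\<theta> * x) * \<theta>)) (at x within UNIV)"
    proof (rule leibniz_rule_field_derivative)
      fix x \<theta> :: real
      show "((\<lambda>x. R t (\<theta> * x)) has_real_derivative R2 t (\<theta> * x) * \<theta>) (at x)"
        by (rule DERIV_chain2[OF has_C1_D2[OF R]]) (auto intro!: derivative_eq_intros t)
      show "(\<lambda>\<theta>. R t (\<theta> * x)) integrable_on cbox 0 1"
        by (intro integrable_continuous cR) (auto intro!: continuous_intros t)
      show "continuous_on (UNIV \<times> cbox 0 1) (\<lambda>(x, \<theta>). R2 t (\<theta> * x) * \<theta>)"
        unfolding case_prod_unfold by (intro continuous_intros cR) (auto intro!: continuous_intros t)
    qed auto
    then have "(G t has_real_derivative integral (cbox 0 1) (\<lambda>\<theta>. R t (\<theta> * x))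
        + x * integral (cbox 0 1) (\<lambda>\<theta>. R2 t (\<theta> * x) * \<theta>)) (at x)"
      unfolding G_def[abs_def] by (auto intro!: derivative_eq_intros)
    also have "integral (cbox 0 1) (\<lambda>\<theta>. R t (\<theta> * x)) + x * integral (cbox 0 1) (\<lambda>\<theta>. R2 t (\<theta> * x) * \<theta>)
      = integral (cbox 0 1) (\<lambda>\<theta>. R t (\<theta> * x) + x * (R2 t (\<theta> * x) * \<theta>))"
      by (subst integral_add) (auto intro!: integrable_continuous_real continuous_intros cR t)
    also have "\<dots> = R t x"
    proof -
      have "((\<lambda>\<theta>. R t (\<theta> * x) + x * (R2 t (\<theta> * x) * \<theta>)) has_integral (1 * R t (1 * x) - 0 * R t (0 * x))) {0..1}"
      proof (rule fundamental_theorem_of_calculus)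
        fix \<theta> :: real
        have "((\<lambda>\<theta>. R t (\<theta> * x)) has_real_derivative R2 t (\<theta> * x) * x) (at \<theta> within {0..1})"
          by (rule DERIV_chain2[OF has_C1_D2[OF R]]) (auto intro!: derivative_eq_intros t)
        then show "((\<lambda>\<theta>. \<theta> * R t (\<theta> * x)) has_vector_derivative R t (\<theta> * x) + x * (R2 t (\<theta> * x) * \<theta>)) (at \<theta> within {0..1})"
          by (auto intro!: derivative_eq_intros simp flip: has_real_derivative_iff_has_vector_derivative)
      qed simp
      then show ?thesis by (simp add: integral_unique)
    qed
    finally show ?thesis .
  qed
  have G1: "((\<lambda>t. G t x) has_real_derivative F t 0 - F t x) (at t within {0..})" if t: "t \<ge> 0" for t x
  proof -
    have "((\<lambda>t. integral (cbox 0 1) (\<lambda>\<theta>. R t (\<theta> * x))) has_real_derivative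
        integral (cbox 0 1) (\<lambda>\<theta>. R1 t (\<theta> * x))) (at t within {0..})"
    proof (rule leibniz_rule_field_derivative)
      fix t \<theta> :: real assume t: "t \<in> {0..}"
      show "((\<lambda>t. R t (\<theta> * x)) has_real_derivative R1 t (\<theta> * x)) (at t within {0..})"
        by (rule has_C1_D1[OF R t])
      show "(\<lambda>\<theta>. R t (\<theta> * x)) integrable_on cbox 0 1"
        by (intro integrable_continuous cR) (use t in \<open>auto intro!: continuous_intros\<close>)
    next
      show "continuous_on ({0..} \<times> cbox 0 1) (\<lambda>(t, \<theta>). R1 t (\<theta> * x))"
        unfolding case_prod_unfold by (intro cR) (auto intro!: continuous_intros)
    qed (use t in auto)
    then have "((\<lambda>t. G t x) has_real_derivative x * integral (cbox 0 1) (\<lambda>\<theta>. R1 t (\<theta> * x))) (at t within {0..})"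
      unfolding G_def by (rule DERIV_cmult)
    also have "x * integral (cbox 0 1) (\<lambda>\<theta>. R1 t (\<theta> * x)) = F t 0 - F t x"
    proof -
      have "((\<lambda>\<theta>. x * R1 t (\<theta> * x)) has_integral (- F t (1 * x) - (- F t (0 * x)))) {0..1}"
      proof (rule fundamental_theorem_of_calculus)
        fix \<theta> :: real
        have "((\<lambda>\<theta>. F t (\<theta> * x)) has_real_derivative F2 t (\<theta> * x) * x) (at \<theta> within {0..1})"
          by (rule DERIV_chain2[OF has_C1_D2[OF F]]) (auto intro!: derivative_eq_intros t)
        moreover have "R1 t (\<theta> * x) = - F2 t (\<theta> * x)"
          using closed[OF t, of "\<theta> * x"] by simp
        ultimately show "((\<lambda>\<theta>. - F t (\<theta> * x)) has_vector_derivative x * R1 t (\<theta> * x)) (at \<theta> within {0..1})"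
          by (auto intro!: derivative_eq_intros simp flip: has_real_derivative_iff_has_vector_derivative)
      qed simp
      then have "integral {0..1} (\<lambda>\<theta>. x * R1 t (\<theta> * x)) = F t 0 - F t x"
        by (simp only: integral_unique) simp
      then show ?thesis by simp
    qed
    finally show ?thesis .
  qed
  have "has_C1 {0..} (\<lambda>t x. G t x - P t) (\<lambda>t x. - F t x) R"
  proof (rule has_C1I)
    fix t x :: real assume "t \<in> {0..}"
    then have t: "t \<ge> 0" by simp
    show "((\<lambda>s. G s x - P s) has_real_derivative - F t x) (at t within {0..})"
      using DERIV_diff[OF G1[OF t, of x] P[OF t]] by simp
    show "((\<lambda>x. G t x - P t) has_real_derivative R t x) (at x)"
      using DERIV_diff[OF G2[OF t] DERIV_const[of "P t"]] by simp
  qed (intro continuous_intros cR cF; auto)+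
  then show thesis by (rule that)
qed

text \<open>The common interface of the cases c > 0 and c = 0: the unforced Euler system, two
  estimates (\<open>pressure_le\<close> and \<open>expanding\<close>), and a particle map whose
  space derivative encodes conservation of mass.\<close>

locale isothermal_flow =
  fixes c K :: real and \<rho>0 v0 :: "real \<Rightarrow> real" and R R1 R2 V V1 V2 Y :: "real \<Rightarrow> real \<Rightarrow> real"
  assumes R_C1: "has_C1 {0..} R R1 R2" and V_C1: "has_C1 {0..} V V1 V2"
    and R_pos: "\<And>t x. t \<ge> 0 \<Longrightarrow> R t x > 0"
    and R_0: "\<And>x. R 0 x = \<rho>0 x" and V_0: "\<And>x. V 0 x = v0 x"
    and mass_eq: "\<And>t x. t \<ge> 0 \<Longrightarrow> R1 t x + V t x * R2 t x + R t x * V2 t x = 0"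
    and momentum_eq: "\<And>t x. t \<ge> 0 \<Longrightarrow> V1 t x + V t x * V2 t x + c\<^sup>2 * (R2 t x / R t x) = 0"
    and pressure_le: "\<And>t x. t \<ge> 0 \<Longrightarrow> \<bar>c\<^sup>2 * (R2 t x / R t x)\<bar> \<le> K"
    and expanding: "\<And>t x. t \<ge> 0 \<Longrightarrow> V2 t x \<ge> 0"
    and Y_C1: "has_C1 {0..} Y (\<lambda>t a. V t (Y t a)) (\<lambda>t a. \<rho>0 a / R t (Y t a))"
    and Y_0: "\<And>a. Y 0 a = a" and Y_surj: "\<And>t. t \<ge> 0 \<Longrightarrow> surj (Y t)"

section \<open>The flow in time and space variables\<close>

context rarefactive_data
begin

lemma char_plus_0: "char_plus 0 a = a"
  by (simp add: char_plus_def pos_def T_diag Q_def)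

lemma char_plus_surj: "\<tau> \<ge> 0 \<Longrightarrow> surj (char_plus \<tau>)"
  by (rule surj_of_deriv_ge_one[OF has_C1_D2[OF char_plus_C1] \<beta>_ge]) simp

lemma char_plus_inj: "\<tau> \<ge> 0 \<Longrightarrow> char_plus \<tau> a = char_plus \<tau> b \<Longrightarrow> a = b"
proof -
  assume \<tau>: "\<tau> \<ge> 0" and eq: "char_plus \<tau> a = char_plus \<tau> b"
  have "char_plus \<tau> x < char_plus \<tau> y" if "x < y" for x y
    by (rule DERIV_pos_imp_increasing[OF that])
      (use \<tau> in \<open>auto intro!: exI[of _ "\<beta> _ (hit _ \<tau>)"] has_C1_D2[OF char_plus_C1]\<close>)
  from this[of a b] this[of b a] eq show "a = b" by (cases a b rule: linorder_cases) auto
qed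

definition foot where "foot \<tau> y = (SOME a. char_plus \<tau> a = y)"
definition foot' where "foot' \<tau> y = hit (foot \<tau> y) \<tau>"
definition V where "V \<tau> y = 1/2 * r (foot \<tau> y) + 1/2 * s (foot' \<tau> y)"
definition V1 where "V1 \<tau> y = 1/2 * (r' (foot \<tau> y) * (- (V \<tau> y + c) / \<beta> (foot \<tau> y) (foot' \<tau> y)))
  + 1/2 * (s' (foot' \<tau> y) * (- (V \<tau> y - c) / \<alpha> (foot \<tau> y) (foot' \<tau> y)))"
definition V2 where "V2 \<tau> y = 1/2 * (r' (foot \<tau> y) * (1 / \<beta> (foot \<tau> y) (foot' \<tau> y)))
  + 1/2 * (s' (foot' \<tau> y) * (1 / \<alpha> (foot \<tau> y) (foot' \<tau> y)))"
definition R where "R \<tau> y = exp (1/(2*c) * r (foot \<tau> y) + (- (1/(2*c))) * s (foot' \<tau> y))"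
definition R1 where "R1 \<tau> y = R \<tau> y *
  (1/(2*c) * (r' (foot \<tau> y) * (- (V \<tau> y + c) / \<beta> (foot \<tau> y) (foot' \<tau> y)))
  + (- (1/(2*c))) * (s' (foot' \<tau> y) * (- (V \<tau> y - c) / \<alpha> (foot \<tau> y) (foot' \<tau> y))))"
definition R2 where "R2 \<tau> y = R \<tau> y *
  (1/(2*c) * (r' (foot \<tau> y) * (1 / \<beta> (foot \<tau> y) (foot' \<tau> y)))
  + (- (1/(2*c))) * (s' (foot' \<tau> y) * (1 / \<alpha> (foot \<tau> y) (foot' \<tau> y))))"

lemma char_plus_foot: "\<tau> \<ge> 0 \<Longrightarrow> char_plus \<tau> (foot \<tau> y) = y"
proof -
  assume "\<tau> \<ge> 0"
  then obtain a where "char_plus \<tau> a = y" using char_plus_surj by (metis surjD)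
  then show ?thesis unfolding foot_def by (rule someI)
qed

lemma foot_char_plus: "\<tau> \<ge> 0 \<Longrightarrow> foot \<tau> (char_plus \<tau> a) = a"
  by (rule char_plus_inj) (auto simp: char_plus_foot)

lemma vel_foot: "vel (foot \<tau> y) (foot' \<tau> y) = V \<tau> y"
  by (simp add: vel_def V_def)

lemma foot_C1: "has_C1 {0..} foot (\<lambda>\<tau> y. - (V \<tau> y + c) / \<beta> (foot \<tau> y) (foot' \<tau> y))
    (\<lambda>\<tau> y. 1 / \<beta> (foot \<tau> y) (foot' \<tau> y))"
  by (rule has_C1_cong[OF has_C1_parametric_inverse[OF char_plus_C1 _ has_C1_snd]])
    (auto simp: char_plus_foot foot'_def[symmetric] vel_foot)

text \<open>Transport of \<open>foot\<close> contributes - (V + c) / \<alpha> and the elapsed time 2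
  c / \<alpha>. Their sum shows that the second foot is carried along backward characteristics,
  although only the forward ones were inverted.\<close>

lemma foot'_C1: "has_C1 {0..} foot' (\<lambda>\<tau> y. - (V \<tau> y - c) / \<alpha> (foot \<tau> y) (foot' \<tau> y))
    (\<lambda>\<tau> y. 1 / \<alpha> (foot \<tau> y) (foot' \<tau> y))"
  unfolding foot'_def[abs_def]
  by (rule has_C1_cong[OF has_C1_compose[OF hit_C1 foot_C1 has_C1_fst]])
    (auto simp: foot'_def[symmetric] field_simps)

lemma V_C1: "has_C1 {0..} V V1 V2"
  unfolding V_def[abs_def] V1_def[abs_def, unfolded V_def] V2_def[abs_def]
  by (rule has_C1_lincomb[OF has_C1_chain[OF foot_C1[unfolded V_def] r r'_cont] has_C1_chain[OF foot'_C1[unfolded V_def] s s'_cont]])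

lemma R_C1: "has_C1 {0..} R R1 R2"
  unfolding R_def[abs_def] R1_def[abs_def, unfolded R_def] R2_def[abs_def, unfolded R_def]
  by (rule has_C1_chain[OF has_C1_lincomb[OF has_C1_chain[OF foot_C1 r r'_cont] has_C1_chain[OF foot'_C1 s s'_cont]]])
    (auto intro!: derivative_eq_intros continuous_intros)

lemma R_pos: "R \<tau> y > 0" by (simp add: R_def)

lemma R_mass_eq: "R1 \<tau> y + V \<tau> y * R2 \<tau> y + R \<tau> y * V2 \<tau> y = 0"
proof -
  \<comment> \<open>\<open>p\<close> and \<open>q\<close> are the space derivatives of the two
    Riemann invariants; in terms of them and V the equation is pure algebra.\<close>
  define p q where "p = r' (foot \<tau> y) / \<beta> (foot \<tau> y) (foot' \<tau> y)" and "q = s' (foot' \<tau> y) / \<alpha> (foot \<tau> y) (foot' \<tau> y)"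
  have *: "R1 \<tau> y = R \<tau> y * (- (V \<tau> y + c) * p + (V \<tau> y - c) * q) / (2 * c)"
    "R2 \<tau> y = R \<tau> y * (p - q) / (2 * c)" "V2 \<tau> y = (p + q) / 2"
    using c by (simp_all add: R1_def R2_def V2_def p_def q_def field_simps)
  show ?thesis unfolding * using c by (simp add: field_simps)
qed

text \<open>The gradients of both invariants are their initial values divided by factors at least 1,
  hence stay between 0 and M. Half their sum is V2, and c times half their difference is the
  pressure force.\<close>

lemma V_momentum_eq: "V1 \<tau> y + V \<tau> y * V2 \<tau> y + c\<^sup>2 * (R2 \<tau> y / R \<tau> y) = 0"
  and V2_ge: "V2 \<tau> y \<ge> 0" and pressure_bound: "\<bar>c\<^sup>2 * (R2 \<tau> y / R \<tau> y)\<bar> \<le> c * M / 2"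
proof -
  define p q where "p = r' (foot \<tau> y) / \<beta> (foot \<tau> y) (foot' \<tau> y)" and "q = s' (foot' \<tau> y) / \<alpha> (foot \<tau> y) (foot' \<tau> y)"
  have V1: "V1 \<tau> y = (- (V \<tau> y + c) * p - (V \<tau> y - c) * q) / 2" and V2: "V2 \<tau> y = (p + q) / 2"
    by (simp_all add: V1_def V2_def p_def q_def field_simps)
  have R2: "R2 \<tau> y / R \<tau> y = (p - q) / (2 * c)"
    using c R_pos[of \<tau> y] by (simp add: R2_def p_def q_def field_simps)
  have R2': "c\<^sup>2 * (R2 \<tau> y / R \<tau> y) = c * (p - q) / 2"
    unfolding R2 using c by (simp add: power2_eq_square)
  show "V1 \<tau> y + V \<tau> y * V2 \<tau> y + c\<^sup>2 * (R2 \<tau> y / R \<tau> y) = 0"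
    unfolding R2' V1 V2 by (simp add: field_simps)
  have pq: "0 \<le> p" "0 \<le> q" "p \<le> M" "q \<le> M"
  proof -
    show "0 \<le> p" "0 \<le> q" by (simp_all add: p_def q_def r'_ge s'_ge less_imp_le)
    have "p \<le> r' (foot \<tau> y) / 1" "q \<le> s' (foot' \<tau> y) / 1"
      unfolding p_def q_def by (intro divide_left_mono \<alpha>_ge \<beta>_ge r'_ge s'_ge; simp)+
    then show "p \<le> M" "q \<le> M" using r'_le[of "foot \<tau> y"] s'_le[of "foot' \<tau> y"] by linarith+
  qed
  show "V2 \<tau> y \<ge> 0" using pq V2 by simp
  have "\<bar>p - q\<bar> \<le> M" using pq by linarith
  then show "\<bar>c\<^sup>2 * (R2 \<tau> y / R \<tau> y)\<bar> \<le> c * M / 2"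
    unfolding R2' using c by (simp add: abs_mult)
qed

lemma foot_0: "foot 0 y = y" "foot' 0 y = y"
  using char_plus_foot[of 0 y] by (simp_all add: char_plus_0 foot'_def)

lemma T_foot: "\<tau> \<ge> 0 \<Longrightarrow> T (foot \<tau> y) (foot' \<tau> y) / (2 * c) = \<tau>"
  using c by (simp add: foot'_def T_hit)

lemma pos_foot: "\<tau> \<ge> 0 \<Longrightarrow> pos (foot \<tau> y) (foot' \<tau> y) = y"
  using char_plus_foot[of \<tau> y] by (simp add: char_plus_def foot'_def)

lemma T_nonneg: "a \<le> b \<Longrightarrow> 0 \<le> T a b"
  using T_strict_mono[of a b a] T_diag[of a a] by (cases "a = b") auto

lemma V_pos:
  assumes "a \<le> b"
  shows "V (T a b / (2 * c)) (pos a b) = vel a b"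
proof -
  have \<tau>: "T a b / (2 * c) \<ge> 0" using T_nonneg[OF assms] c by simp
  have "foot (T a b / (2 * c)) (pos a b) = a"
    using foot_char_plus[OF \<tau>, of a] by (simp add: char_plus_def hit_T)
  then show ?thesis by (simp flip: vel_foot add: foot'_def hit_T)
qed

text \<open>Every characteristic crosses particle paths in one direction only, so the mass to the left
  of \<open>y\<close> at time \<open>\<tau>\<close> lies between the initial masses to the left of the two feet of the
  characteristics through \<open>(\<tau>, y)\<close>.\<close>

lemma potential_between:
  assumes N: "has_C1 {0..} N (\<lambda>\<tau> y. - (R \<tau> y * V \<tau> y)) R" and \<tau>: "\<tau> \<ge> 0"
  shows "N 0 (foot \<tau> y) \<le> N \<tau> y" and "N \<tau> y \<le> N 0 (foot' \<tau> y)"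
proof -
  let ?a = "foot \<tau> y" and ?b = "foot' \<tau> y"
  have "N 0 (char_plus 0 ?a) \<le> N \<tau> (char_plus \<tau> ?a)"
  proof (rule within_deriv_nonneg_imp_le[OF \<tau>])
    fix t assume t: "t \<in> {0..\<tau>}"
    have Vt: "V t (char_plus t ?a) = vel ?a (hit ?a t)"
      using foot_char_plus[of t ?a] t by (simp flip: vel_foot add: foot'_def)
    show "((\<lambda>t. N t (char_plus t ?a)) has_real_derivative c * R t (char_plus t ?a)) (at t within {0..\<tau>})"
    proof (rule has_C1_curve[OF N t _ DERIV_ident])
      show "((\<lambda>t. char_plus t ?a) has_real_derivative vel ?a (hit ?a t) + c) (at t within {0..\<tau>})"
        by (rule DERIV_subset[OF has_C1_D1[OF char_plus_C1]]) (use t in auto)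
      show "- (R t (char_plus t ?a) * V t (char_plus t ?a)) * 1 + R t (char_plus t ?a) * (vel ?a (hit ?a t) + c)
        = c * R t (char_plus t ?a)"
        unfolding Vt by (simp add: algebra_simps)
    qed auto
    show "0 \<le> c * R t (char_plus t ?a)" using c R_pos[of t "char_plus t ?a"] by simp
  qed
  then show "N 0 (foot \<tau> y) \<le> N \<tau> y" using \<tau> by (simp add: char_plus_0 char_plus_foot)
  have ab: "?a \<le> ?b" unfolding foot'_def by (rule hit_ge[OF \<tau>])
  \<comment> \<open>The backward characteristic through (\<tau>, y) is parametrized by the other
    foot: as a increases to \<open>?b\<close>, time decreases from \<tau> to 0.\<close>
  let ?t = "\<lambda>a. T a ?b / (2 * c)"
  have "N (?t ?a) (pos ?a ?b) \<le> N (?t ?b) (pos ?b ?b)"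
  proof (rule within_deriv_nonneg_imp_le[OF ab])
    fix a assume a: "a \<in> {?a..?b}"
    then have a': "a \<le> ?b" by simp
    show "((\<lambda>a. N (?t a) (pos a ?b)) has_real_derivative R (?t a) (pos a ?b) * \<beta> a ?b / 2) (at a within {?a..?b})"
    proof (rule has_C1_curve[OF N a])
      show "?t x \<in> {0..}" if "x \<in> {?a..?b}" for x using that T_nonneg[of x ?b] c by simp
      show "(?t has_real_derivative - \<beta> a ?b / (2 * c)) (at a within {?a..?b})"
        by (intro DERIV_cdivide DERIV_subset[OF has_C1_D1[OF T_C1]]) auto
      show "((\<lambda>a. pos a ?b) has_real_derivative - (vel a ?b - c) * \<beta> a ?b / (2 * c)) (at a within {?a..?b})"
        unfolding pos_D1[OF a', symmetric] by (rule DERIV_subset[OF has_C1_D1[OF pos_C1]]) auto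
      show "- (R (?t a) (pos a ?b) * V (?t a) (pos a ?b)) * (- \<beta> a ?b / (2 * c))
         + R (?t a) (pos a ?b) * (- (vel a ?b - c) * \<beta> a ?b / (2 * c)) = R (?t a) (pos a ?b) * \<beta> a ?b / 2"
        unfolding V_pos[OF a'] using c by (simp add: field_simps)
    qed
    show "0 \<le> R (?t a) (pos a ?b) * \<beta> a ?b / 2"
      using R_pos[of "?t a" "pos a ?b"] by (simp add: less_imp_le)
  qed
  moreover have "pos ?b ?b = ?b" "T ?b ?b = 0"
    by (simp_all add: pos_def T_diag Q_def)
  ultimately show "N \<tau> y \<le> N 0 (foot' \<tau> y)"
    using T_foot[OF \<tau>, of y] pos_foot[OF \<tau>, of y] by simp
qed

text \<open>Particle paths are level sets of the mass potential rather than solutions of an ODE, so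
  the Jacobian rho_0 / R comes from implicit differentiation. The bounds along characteristics show
  that the potential takes the same values at every time, whether or not the total mass is
  finite.\<close>

theorem exists_isothermal_flow:
  assumes "\<And>x. \<rho>0 x = exp ((r x - s x) / (2 * c))" and "\<And>x. v0 x = (r x + s x) / 2"
  shows "\<exists>Y. isothermal_flow c (c * M / 2) \<rho>0 v0 R R1 R2 V V1 V2 Y"
proof -
  have R0: "R 0 x = \<rho>0 x" and V0: "V 0 x = v0 x" for x
    by (simp_all add: R_def V_def foot_0 assms diff_divide_distrib add_divide_distrib)
  have Rnz: "R \<tau> y \<noteq> 0" for \<tau> y using R_pos[of \<tau> y] by simp
  have RV: "has_C1 {0..} (\<lambda>\<tau> y. R \<tau> y * V \<tau> y) (\<lambda>\<tau> y. R1 \<tau> y * V \<tau> y + V1 \<tau> y * R \<tau> y)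
     (\<lambda>\<tau> y. R2 \<tau> y * V \<tau> y + V2 \<tau> y * R \<tau> y)"
    by (rule has_C1_mult[OF R_C1 V_C1])
  obtain N where N: "has_C1 {0..} N (\<lambda>\<tau> y. - (R \<tau> y * V \<tau> y)) R"
    by (rule exists_mass_potential[OF R_C1 RV]) (use R_mass_eq in \<open>simp add: algebra_simps\<close>)
  have N_cont: "continuous_on S (N \<tau>)" if "\<tau> \<ge> 0" for \<tau> S
    by (rule has_C1_cont[OF N]) (use that in \<open>auto intro: continuous_intros\<close>)
  have N_mono: "N \<tau> x < N \<tau> y" if "x < y" "\<tau> \<ge> 0" for \<tau> x y
    by (rule DERIV_pos_imp_increasing[OF that(1)])
      (use that R_pos in \<open>auto intro!: exI[of _ "R \<tau> _"] has_C1_D2[OF N]\<close>)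
  have N_ivt: "\<exists>x. N \<tau> x = z" if "N \<tau> p \<le> z" "z \<le> N \<tau> q" "\<tau> \<ge> 0" for \<tau> p q z
  proof -
    have "p \<le> q" using N_mono[of q p \<tau>] that by (cases "p \<le> q") auto
    from IVT'[OF that(1,2) this N_cont[OF that(3)]] show ?thesis by blast
  qed
  have ex: "\<exists>y. N \<tau> y = N 0 a" if \<tau>: "\<tau> \<ge> 0" for \<tau> a
  proof (rule N_ivt[OF _ _ \<tau>])
    show "N 0 a \<le> N \<tau> (char_plus \<tau> a)"
      using potential_between(1)[OF N \<tau>, of "char_plus \<tau> a"] foot_char_plus[OF \<tau>] by simp
    \<comment> \<open>The shift is the bound of \<open>hit_le\<close>: the backward foot of the
      point reached from \<open>b\<close> then does not exceed \<open>a\<close>.\<close>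
    define b where "b = a - 2 * c * \<tau>"
    have "foot' \<tau> (char_plus \<tau> b) \<le> a"
      using hit_le[OF \<tau>, of b] foot_char_plus[OF \<tau>, of b] by (simp add: foot'_def b_def)
    then have "N 0 (foot' \<tau> (char_plus \<tau> b)) \<le> N 0 a"
      using N_mono[of "foot' \<tau> (char_plus \<tau> b)" a 0]
      by (cases "foot' \<tau> (char_plus \<tau> b) = a") simp_all
    then show "N \<tau> (char_plus \<tau> b) \<le> N 0 a"
      using potential_between(2)[OF N \<tau>, of "char_plus \<tau> b"] by simp
  qed
  define Y where "Y \<tau> a = (SOME y. N \<tau> y = N 0 a)" for \<tau> a
  have Y: "N \<tau> (Y \<tau> a) = N 0 a" if "\<tau> \<ge> 0" for \<tau> a
    unfolding Y_def by (rule someI_ex[OF ex[OF that]])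
  have N_inj: "x = y" if "N \<tau> x = N \<tau> y" "\<tau> \<ge> 0" for \<tau> x y
    using N_mono[of x y \<tau>] N_mono[of y x \<tau>] that by (cases x y rule: linorder_cases) auto
  have k: "has_C1 {0..} (\<lambda>\<tau>::real. N 0) (\<lambda>\<tau> a. 0) (\<lambda>\<tau> a. R 0 a)"
  proof (rule has_C1I)
    show "continuous_on ({0..} \<times> UNIV) (\<lambda>p::real\<times>real. R 0 (snd p))"
      by (rule has_C1_cont[OF R_C1]) (auto intro: continuous_intros)
  qed (simp_all add: has_C1_D2[OF N] continuous_on_const)
  have Y_C1: "has_C1 {0..} Y (\<lambda>\<tau> a. V \<tau> (Y \<tau> a)) (\<lambda>\<tau> a. \<rho>0 a / R \<tau> (Y \<tau> a))"
    by (rule has_C1_cong[OF has_C1_parametric_inverse[OF N R_pos k Y]])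
      (auto simp: R0 Rnz)
  have "isothermal_flow c (c * M / 2) \<rho>0 v0 R R1 R2 V V1 V2 Y"
  proof (rule isothermal_flow.intro[OF R_C1 V_C1 R_pos R0 V0 R_mass_eq V_momentum_eq pressure_bound V2_ge Y_C1])
    show "Y 0 a = a" for a by (rule N_inj[of 0]) (simp_all add: Y)
    fix \<tau> :: real assume \<tau>: "\<tau> \<ge> 0"
    have "\<exists>a. y = Y \<tau> a" for y
    proof -
      have "\<exists>a. N 0 a = N \<tau> y"
        by (rule N_ivt[OF potential_between[OF N \<tau>]]) simp
      then obtain a where a: "N 0 a = N \<tau> y" by blast
      have "y = Y \<tau> a" by (rule N_inj[OF _ \<tau>]) (simp add: Y[OF \<tau>] a)
      then show ?thesis by blast
    qed
    then show "surj (Y \<tau>)" by (simp add: surj_def)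
  qed
  then show ?thesis by blast
qed

end

section \<open>Conservation of mass and momentum\<close>

text \<open>The general theorem speaks of absolute integrability with respect to the completed
  measure; continuity of \<open>f\<close> gives the Borel measurability needed to return to
  \<open>lborel\<close>.\<close>

lemma lborel_change_of_variables:
  fixes f g :: "real \<Rightarrow> real"
  assumes g: "\<And>x. (g has_real_derivative g' x) (at x)" "\<And>x. g' x > 0" "surj g"
    and f: "continuous_on UNIV f" and int: "integrable lborel (\<lambda>x. g' x * f (g x))"
  shows "integrable lborel f" and "(LINT x|lborel. f x) = (LINT x|lborel. g' x * f (g x))"
proof -
  have mono: "x < y \<Longrightarrow> g x < g y" for x y
    using DERIV_pos_imp_increasing[of x y g] g by blast
  have inj: "inj g"
    by (metis injI less_irrefl linorder_neqE_linordered_idom mono)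
  let ?I = "LINT x|lborel. g' x * f (g x)"
  have "(\<lambda>x. \<bar>g' x\<bar> * f (g x)) absolutely_integrable_on UNIV"
    using integrable_completion[of "\<lambda>x. g' x * f (g x)" lborel] int g(2)
    by (simp add: set_integrable_def abs_of_pos)
  moreover have "integral UNIV (\<lambda>x. \<bar>g' x\<bar> * f (g x)) = ?I"
    using has_integral_integral_lborel[OF int] g(2) by (simp add: abs_of_pos integral_unique)
  ultimately have *: "f absolutely_integrable_on UNIV \<and> integral UNIV f = ?I"
    using has_absolute_integral_change_of_variables_1'[of UNIV g g' f ?I] g inj by simp
  have "f \<in> borel_measurable lborel"
    using borel_measurable_continuous_onI[OF f] by simp
  then show I: "integrable lborel f"
    using * integrable_completion[of f lborel] by (simp add: set_integrable_def)
  show "(LINT x|lborel. f x) = ?I"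
    using has_integral_integral_lborel[OF I] * by (simp add: integral_unique)
qed

lemma tendsto_integral_symmetric_interval:
  fixes f :: "real \<Rightarrow> real"
  assumes f: "continuous_on UNIV f" "integrable lborel f"
  shows "(\<lambda>n. integral {- real n..real n} f) \<longlonglongrightarrow> (LINT x|lborel. f x)"
proof -
  have "(\<lambda>n. LINT x|lborel. indicator {- real n..real n} x * f x) \<longlonglongrightarrow> (LINT x|lborel. f x)"
  proof (rule integral_dominated_convergence[where w = "\<lambda>x. \<bar>f x\<bar>"])
    show "AE x in lborel. (\<lambda>n. indicator {- real n..real n} x * f x) \<longlonglongrightarrow> f x"
    proof (intro AE_I2 tendsto_eventually)
      fix x :: real
      obtain k where "\<bar>x\<bar> \<le> real k" using real_arch_simple by blast
      then have "\<forall>n\<ge>k. indicator {- real n..real n} x * f x = f x"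
        by (auto simp: indicator_def)
      then show "eventually (\<lambda>n. indicator {- real n..real n} x * f x = f x) sequentially"
        by (auto simp: eventually_sequentially)
    qed
    show "AE x in lborel. norm (indicator {- real n..real n} x * f x) \<le> \<bar>f x\<bar>" for n
      by (auto simp: indicator_def)
  qed (use f borel_measurable_continuous_onI[OF f(1)] in auto)
  then show ?thesis by (simp add: lborel_integral_indicator_Icc[OF f(1)])
qed

text \<open>The bound on \<open>\<rho>' / \<rho>\<close> makes \<open>\<rho>\<close> comparable to its mean over adjacent unit intervals.\<close>

lemma log_lipschitz_density_vanishes:
  fixes \<rho> \<rho>' :: "real \<Rightarrow> real"
  assumes d: "\<And>x. (\<rho> has_real_derivative \<rho>' x) (at x)" and pos: "\<And>x. \<rho> x > 0"
    and le: "\<And>x. \<bar>\<rho>' x / \<rho> x\<bar> \<le> L" and int: "integrable lborel \<rho>"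
  shows "(\<lambda>n. \<rho> (real n) + \<rho> (- real n)) \<longlonglongrightarrow> 0"
proof -
  have cont: "continuous_on S \<rho>" for S
    by (meson DERIV_continuous_on d has_field_derivative_at_within)
  have L: "L \<ge> 0" using le[of 0] by linarith
  have cmp: "\<rho> x \<le> exp L * \<rho> y" if "\<bar>x - y\<bar> \<le> 1" for x y
  proof -
    have "norm (ln (\<rho> x) - ln (\<rho> y)) \<le> L * norm (x - y)"
    proof (rule field_differentiable_bound[where S = UNIV])
      fix z show "((\<lambda>z. ln (\<rho> z)) has_real_derivative \<rho>' z / \<rho> z) (at z within UNIV)"
        using d pos by (auto intro!: derivative_eq_intros)
      show "norm (\<rho>' z / \<rho> z) \<le> L" using le[of z] by simp
    qed auto
    also have "\<dots> \<le> L * 1" using that L by (intro mult_left_mono) auto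
    finally have "ln (\<rho> x) \<le> L + ln (\<rho> y)" by simp
    then have "exp (ln (\<rho> x)) \<le> exp (L + ln (\<rho> y))" by simp
    then show ?thesis using pos by (simp add: exp_add)
  qed
  \<comment> \<open>The increments of \<open>G\<close> are the masses of two unit intervals at
    distance n; they tend to 0 because the total mass is finite.\<close>
  define G where "G n = integral {- real n..real n} \<rho>" for n
  have G: "G \<longlonglongrightarrow> (LINT x|lborel. \<rho> x)"
    unfolding G_def by (rule tendsto_integral_symmetric_interval[OF cont int])
  have "(\<lambda>n. exp L * (G (Suc n) - G n)) \<longlonglongrightarrow> exp L * ((LINT x|lborel. \<rho> x) - (LINT x|lborel. \<rho> x))"
    by (intro tendsto_intros LIMSEQ_Suc G)
  then have lim: "(\<lambda>n. exp L * (G (Suc n) - G n)) \<longlonglongrightarrow> 0" by simp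
  have int': "\<rho> integrable_on {a..b}" for a b by (rule integrable_continuous_real[OF cont])
  have bd: "\<rho> (real n) + \<rho> (- real n) \<le> exp L * (G (Suc n) - G n)" for n
  proof -
    have "integral {- real (Suc n)..- real n} \<rho> + integral {- real n..real (Suc n)} \<rho> = G (Suc n)"
      unfolding G_def by (intro Henstock_Kurzweil_Integration.integral_combine int') auto
    moreover have "G n + integral {real n..real (Suc n)} \<rho> = integral {- real n..real (Suc n)} \<rho>"
      unfolding G_def by (intro Henstock_Kurzweil_Integration.integral_combine int') auto
    moreover have "\<rho> x \<le> exp L * integral {a..a + 1} \<rho>" if "x \<in> {a..a + 1}" for x a
    proof -
      have "\<rho> x = integral {a..a + 1} (\<lambda>_. \<rho> x)" by simp
      also have "\<dots> \<le> integral {a..a + 1} (\<lambda>y. exp L * \<rho> y)"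
        by (intro integral_le integrable_continuous_real continuous_intros cont cmp)
          (use that in \<open>auto simp: abs_le_iff\<close>)
      finally show ?thesis by simp
    qed
    from this[of "real n" "real n"] this[of "- real n" "- real (Suc n)"]
    have "\<rho> (real n) \<le> exp L * integral {real n..real (Suc n)} \<rho>"
      "\<rho> (- real n) \<le> exp L * integral {- real (Suc n)..- real n} \<rho>"
      by (simp_all add: add.commute)
    ultimately have "\<rho> (real n) + \<rho> (- real n) \<le> exp L * integral {real n..real (Suc n)} \<rho>
        + exp L * integral {- real (Suc n)..- real n} \<rho>"
      and "G (Suc n) - G n = integral {real n..real (Suc n)} \<rho> + integral {- real (Suc n)..- real n} \<rho>"
      by linarith+
    then show ?thesis by (simp only: distrib_left)
  qed
  show ?thesis
    by (rule tendsto_sandwich[OF _ _ tendsto_const lim])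
      (use bd add_pos_pos[OF pos pos] in \<open>auto intro!: always_eventually less_imp_le\<close>)
qed

section \<open>Balance laws in particle coordinates\<close>

context isothermal_flow
begin

lemma \<rho>0_eq: "\<rho>0 = R 0" by (simp add: R_0 fun_eq_iff)

lemma \<rho>0_D: "(\<rho>0 has_real_derivative R2 0 x) (at x)"
  unfolding \<rho>0_eq by (rule has_C1_D2[OF R_C1]) simp

lemma \<rho>0_cont: "continuous_on S \<rho>0"
  by (meson DERIV_continuous_on \<rho>0_D has_field_derivative_at_within)

lemma \<rho>0_pos: "\<rho>0 x > 0"
  using R_pos[of 0 x] by (simp add: R_0)

text \<open>Along a path the derivative of R is - R V2, which is nonpositive because the flow
  expands. This bounds later boundary terms by initial data.\<close>

lemma R_along_path_le:
  assumes "t \<ge> 0"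
  shows "R t (Y t a) \<le> \<rho>0 a"
proof -
  have "- R 0 (Y 0 a) \<le> - R t (Y t a)"
  proof (rule within_deriv_nonneg_imp_le[OF assms])
    fix s assume s: "s \<in> {0..t}"
    have "((\<lambda>s. R s (Y s a)) has_real_derivative - (R s (Y s a) * V2 s (Y s a))) (at s within {0..t})"
    proof (rule has_C1_curve[OF R_C1 s _ DERIV_ident])
      show "((\<lambda>s. Y s a) has_real_derivative V s (Y s a)) (at s within {0..t})"
        by (rule DERIV_subset[OF has_C1_D1[OF Y_C1]]) (use s in auto)
    qed (use s mass_eq[of s "Y s a"] in \<open>auto simp: algebra_simps\<close>)
    then show "((\<lambda>s. - R s (Y s a)) has_real_derivative R s (Y s a) * V2 s (Y s a)) (at s within {0..t})"
      using DERIV_minus by fastforce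
    show "0 \<le> R s (Y s a) * V2 s (Y s a)"
      using s R_pos[of s "Y s a"] expanding[of s "Y s a"] by simp
  qed
  then show ?thesis by (simp add: R_0 Y_0)
qed

text \<open>In terms of the original velocity \<open>u\<close>, \<open>W\<close> is \<open>e\<^bsup>Ct\<^esup> (u - m)\<close> along the particle path of \<open>a\<close>.\<close>

definition W where "W C t a = (1 + C * t) * V t (Y t a) - C * Y t a"

text \<open>The weight 1 + C t makes the two terms C V cancel, so that only the pressure changes
  \<open>W\<close>.\<close>

lemma W_D:
  assumes "t \<ge> 0"
  shows "((\<lambda>t. W C t a) has_real_derivative - ((1 + C * t) * (c\<^sup>2 * (R2 t (Y t a) / R t (Y t a))))) (at t within {0..})"
proof -
  have t: "t \<in> {0..}" using assms by simp
  have Y: "((\<lambda>s. Y s a) has_real_derivative V t (Y t a)) (at t within {0..})"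
    by (rule has_C1_D1[OF Y_C1 t])
  have "((\<lambda>s. V s (Y s a)) has_real_derivative - (c\<^sup>2 * (R2 t (Y t a) / R t (Y t a)))) (at t within {0..})"
    by (rule has_C1_curve[OF V_C1 t _ DERIV_ident Y]) (use momentum_eq[of t "Y t a"] assms in \<open>auto simp: algebra_simps\<close>)
  then show ?thesis
    unfolding W_def[abs_def] by (auto intro!: derivative_eq_intros Y simp: algebra_simps add_divide_distrib)
qed

lemma W_0: "W C 0 a = v0 a - C * a"
  by (simp add: W_def V_0 Y_0)

lemma Y_cont: "t \<ge> 0 \<Longrightarrow> continuous_on S (Y t)"
  by (rule has_C1_cont[OF Y_C1]) (auto intro: continuous_intros)

lemma W_cont: "t \<ge> 0 \<Longrightarrow> continuous_on S (W C t)"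
  unfolding W_def[abs_def]
  by (intro continuous_intros has_C1_cont[OF V_C1] Y_cont) auto

lemma W_diff_le:
  assumes "C \<ge> 0" "t \<ge> 0"
  shows "\<bar>W C t a - W C 0 a\<bar> \<le> (1 + C * t) * K * t"
proof -
  have "norm (W C t a - W C 0 a) \<le> (1 + C * t) * K * norm (t - 0)"
  proof (rule field_differentiable_bound[where S = "{0..t}"])
    fix s assume s: "s \<in> {0..t}"
    show "((\<lambda>t. W C t a) has_real_derivative - ((1 + C * s) * (c\<^sup>2 * (R2 s (Y s a) / R s (Y s a))))) (at s within {0..t})"
      by (rule DERIV_subset[OF W_D]) (use s in auto)
    have "(1 + C * s) * \<bar>c\<^sup>2 * (R2 s (Y s a) / R s (Y s a))\<bar> \<le> (1 + C * t) * K"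
      using s assms by (intro mult_mono pressure_le add_mono mult_left_mono) auto
    then show "norm (- ((1 + C * s) * (c\<^sup>2 * (R2 s (Y s a) / R s (Y s a))))) \<le> (1 + C * t) * K"
      using s assms by (simp add: abs_mult)
  qed (use assms in auto)
  then show ?thesis using assms by simp
qed

text \<open>The pressure bound keeps \<open>W\<close> within a distance of its initial value that is
  uniform over all particles; finite mass then transfers integrability.\<close>

lemma \<rho>0_W_integrable:
  assumes "C \<ge> 0" "t \<ge> 0" and int: "integrable lborel \<rho>0" "integrable lborel (\<lambda>a. \<rho>0 a * W C 0 a)"
  shows "integrable lborel (\<lambda>a. \<rho>0 a * W C t a)"
proof (rule Bochner_Integration.integrable_bound[where f = "\<lambda>a. \<bar>\<rho>0 a * W C 0 a\<bar> + ((1 + C * t) * K * t) * \<rho>0 a"])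
  show "(\<lambda>a. \<rho>0 a * W C t a) \<in> borel_measurable lborel"
    using borel_measurable_continuous_onI[OF continuous_on_mult[OF \<rho>0_cont W_cont[OF assms(2)]]] by simp
  show "AE a in lborel. norm (\<rho>0 a * W C t a) \<le> norm (\<bar>\<rho>0 a * W C 0 a\<bar> + ((1 + C * t) * K * t) * \<rho>0 a)"
  proof (rule AE_I2)
    fix a
    have "\<bar>W C t a\<bar> \<le> \<bar>W C 0 a\<bar> + (1 + C * t) * K * t"
      using W_diff_le[OF assms(1,2), of a] by linarith
    then have "\<rho>0 a * \<bar>W C t a\<bar> \<le> \<rho>0 a * (\<bar>W C 0 a\<bar> + (1 + C * t) * K * t)"
      by (rule mult_left_mono) (use \<rho>0_pos[of a] in simp)
    then show "norm (\<rho>0 a * W C t a) \<le> norm (\<bar>\<rho>0 a * W C 0 a\<bar> + ((1 + C * t) * K * t) * \<rho>0 a)"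
      using \<rho>0_pos[of a] by (simp add: abs_mult algebra_simps)
  qed
qed (use int in auto)

text \<open>As the particle map has derivative rho_0 / R, the product of rho_0 with R2 / R along
  paths is the derivative of \<open>R t (Y t a)\<close> in a. Momentum on a symmetric interval thus
  changes only through the end values of R, which lie between 0 and rho_0 there.\<close>

lemma integral_\<rho>0_W_diff_le:
  assumes "C \<ge> 0" "t \<ge> 0" "n \<ge> 0"
  shows "\<bar>integral {- n..n} (\<lambda>a. \<rho>0 a * W C t a) - integral {- n..n} (\<lambda>a. \<rho>0 a * W C 0 a)\<bar>
    \<le> (1 + C * t) * c\<^sup>2 * t * (\<rho>0 n + \<rho>0 (- n))"
proof -
  let ?p = "\<lambda>t a. - ((1 + C * t) * (c\<^sup>2 * (R2 t (Y t a) / R t (Y t a))))"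
  let ?I = "\<lambda>t. integral (cbox (- n) n) (\<lambda>a. \<rho>0 a * W C t a)"
  let ?D = "\<lambda>t. - ((1 + C * t) * c\<^sup>2 * (R t (Y t n) - R t (Y t (- n))))"
  have D: "(?I has_real_derivative ?D s) (at s within {0..})" if s: "s \<ge> 0" for s
  proof -
    have "(?I has_real_derivative integral (cbox (- n) n) (\<lambda>a. \<rho>0 a * ?p s a)) (at s within {0..})"
    proof (rule leibniz_rule_field_derivative)
      fix t a :: real assume t: "t \<in> {0..}"
      show "((\<lambda>t. \<rho>0 a * W C t a) has_real_derivative \<rho>0 a * ?p t a) (at t within {0..})"
        by (rule DERIV_cmult[OF W_D]) (use t in simp)
      show "(\<lambda>a. \<rho>0 a * W C t a) integrable_on cbox (- n) n"
        by (intro integrable_continuous continuous_on_mult \<rho>0_cont W_cont) (use t in simp)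
    next
      have f: "continuous_on ({0..} \<times> cbox (- n) n) (\<lambda>q::real\<times>real. fst q)"
        "continuous_on ({0..} \<times> cbox (- n) n) (\<lambda>q::real\<times>real. snd q)" by (auto intro: continuous_intros)
      have y: "continuous_on ({0..} \<times> cbox (- n) n) (\<lambda>q. Y (fst q) (snd q))"
        by (rule has_C1_cont[OF Y_C1 f]) auto
      have "continuous_on ({0..} \<times> cbox (- n) n) (\<lambda>q::real\<times>real. \<rho>0 (snd q))"
        by (rule continuous_on_compose2[OF \<rho>0_cont[of UNIV] f(2)]) auto
      moreover have "continuous_on ({0..} \<times> cbox (- n) n) (\<lambda>q. R2 (fst q) (Y (fst q) (snd q)))"
        "continuous_on ({0..} \<times> cbox (- n) n) (\<lambda>q. R (fst q) (Y (fst q) (snd q)))"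
        by (rule has_C1_cont_partial(2)[OF R_C1 f(1) y] has_C1_cont[OF R_C1 f(1) y]; auto)+
      moreover have "\<forall>q\<in>{0..} \<times> cbox (- n) n. R (fst q) (Y (fst q) (snd q)) \<noteq> 0"
        using R_pos by (auto simp: less_le)
      ultimately show "continuous_on ({0..} \<times> cbox (- n) n) (\<lambda>(t, a). \<rho>0 a * ?p t a)"
        unfolding case_prod_unfold by (intro continuous_intros)
    qed (use s in auto)
    also have "integral (cbox (- n) n) (\<lambda>a. \<rho>0 a * ?p s a) = ?D s"
    proof -
      have "((\<lambda>a. \<rho>0 a * ?p s a) has_integral
          (- ((1 + C * s) * c\<^sup>2) * R s (Y s n) - (- ((1 + C * s) * c\<^sup>2) * R s (Y s (- n))))) {- n..n}"
      proof (rule fundamental_theorem_of_calculus)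
        fix a :: real
        have "((\<lambda>a. R s (Y s a)) has_real_derivative R2 s (Y s a) * (\<rho>0 a / R s (Y s a))) (at a within {- n..n})"
          by (rule DERIV_chain2[OF has_C1_D2[OF R_C1] DERIV_subset[OF has_C1_D2[OF Y_C1]]]) (use s in auto)
        from DERIV_cmult[OF this, of "- ((1 + C * s) * c\<^sup>2)"]
        show "((\<lambda>a. - ((1 + C * s) * c\<^sup>2) * R s (Y s a)) has_vector_derivative \<rho>0 a * ?p s a) (at a within {- n..n})"
          by (simp add: mult_ac flip: has_real_derivative_iff_has_vector_derivative)
      qed (use assms in simp)
      then show ?thesis by (simp only: integral_unique interval_cbox) (simp add: algebra_simps)
    qed
    finally show ?thesis .
  qed
  have "norm (?I t - ?I 0) \<le> (1 + C * t) * c\<^sup>2 * (\<rho>0 n + \<rho>0 (- n)) * norm (t - 0)"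
  proof (rule field_differentiable_bound[where S = "{0..t}"])
    fix s assume s: "s \<in> {0..t}"
    show "(?I has_real_derivative ?D s) (at s within {0..t})"
      by (rule DERIV_subset[OF D]) (use s in auto)
    have "\<bar>R s (Y s n) - R s (Y s (- n))\<bar> \<le> \<rho>0 n + \<rho>0 (- n)"
      using s R_along_path_le[of s n] R_along_path_le[of s "- n"] R_pos[of s "Y s n"] R_pos[of s "Y s (- n)"]
      by (auto simp: abs_le_iff)
    then have "((1 + C * s) * c\<^sup>2) * \<bar>R s (Y s n) - R s (Y s (- n))\<bar> \<le> ((1 + C * t) * c\<^sup>2) * (\<rho>0 n + \<rho>0 (- n))"
      using s assms by (intro mult_mono add_mono mult_left_mono) auto
    then show "norm (?D s) \<le> (1 + C * t) * c\<^sup>2 * (\<rho>0 n + \<rho>0 (- n))"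
      using s assms by (simp add: abs_mult)
  qed (use assms in auto)
  then show ?thesis using assms by (simp add: mult_ac)
qed

lemma integral_\<rho>0_W:
  assumes "C \<ge> 0" "t \<ge> 0" and int: "integrable lborel \<rho>0" "integrable lborel (\<lambda>a. \<rho>0 a * W C 0 a)"
  shows "(LINT a|lborel. \<rho>0 a * W C t a) = (LINT a|lborel. \<rho>0 a * W C 0 a)"
proof -
  have lim: "(\<lambda>n. integral {- real n..real n} (\<lambda>a. \<rho>0 a * W C s a)) \<longlonglongrightarrow> (LINT a|lborel. \<rho>0 a * W C s a)"
    if "s \<ge> 0" for s
    by (rule tendsto_integral_symmetric_interval)
      (use \<rho>0_W_integrable[OF assms(1) that int] in \<open>auto intro!: continuous_on_mult \<rho>0_cont W_cont that\<close>)
  have zero: "(\<lambda>n. (1 + C * t) * c\<^sup>2 * t * (\<rho>0 (real n) + \<rho>0 (- real n))) \<longlonglongrightarrow> 0"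
  \<comment> \<open>For c = 0 the prefactor vanishes. Otherwise the pressure bound at time 0
    controls the logarithmic derivative of rho_0 and forces the end values to 0.\<close>
  proof (cases "c = 0")
    case False
    have "(\<lambda>n. \<rho>0 (real n) + \<rho>0 (- real n)) \<longlonglongrightarrow> 0"
    proof (rule log_lipschitz_density_vanishes[OF \<rho>0_D \<rho>0_pos _ int(1)])
      show "\<bar>R2 0 x / \<rho>0 x\<bar> \<le> K / c\<^sup>2" for x
        using pressure_le[of 0 x] False by (simp add: R_0 abs_mult pos_le_divide_eq mult.commute)
    qed
    from tendsto_mult_right_zero[OF this] show ?thesis by simp
  qed simp
  have "(\<lambda>n. integral {- real n..real n} (\<lambda>a. \<rho>0 a * W C t a) - integral {- real n..real n} (\<lambda>a. \<rho>0 a * W C 0 a)) \<longlonglongrightarrow> 0"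
    by (rule Lim_null_comparison[OF _ zero])
      (use integral_\<rho>0_W_diff_le[OF assms(1,2)] in \<open>auto intro!: always_eventually\<close>)
  from LIMSEQ_unique[OF this tendsto_diff[OF lim[OF assms(2)] lim[of 0]]] show ?thesis by simp
qed

end

text \<open>The factor in \<rho> is the Jacobian of x to y. Integrals of the state are pulled back
  by the particle map in the original variables, where the momentum becomes m plus a multiple of the
  integral of rho_0 W. By unit mass and the choice of m that integral is 0 initially, and it is
  conserved.\<close>

theorem (in isothermal_flow) classical_solution_of_flow:
  fixes C :: real and u0
  defines "m \<equiv> momentum \<rho>0 u0"
  assumes C: "C > 0" and adm: "admissible_state \<rho>0 u0" and v0: "\<And>x. v0 x = u0 x - m + C * x"
  shows "\<exists>\<rho> u. classical_solution (c\<^sup>2) C \<rho>0 u0 {0..} \<rho> u"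
proof -
  define \<tau> where "\<tau> t = (exp (C * t) - 1) / C" for t
  define \<eta> where "\<eta> t x = exp (C * t) * (x - m * t)" for t x
  define \<rho> where "\<rho> t x = exp (C * t) * R (\<tau> t) (\<eta> t x)" for t x
  define u where "u t x = m + V (\<tau> t) (\<eta> t x) - C * (x - m * t)" for t x
  have \<tau>_nonneg: "\<tau> t \<ge> 0" if "t \<ge> 0" for t
    using that C by (simp add: \<tau>_def)
  have exp_eq: "exp (C * t) = 1 + C * \<tau> t" for t
    using C by (simp add: \<tau>_def)
  have \<tau>_C1: "has_C1 {0..} (\<lambda>t x. \<tau> t) (\<lambda>t x. exp (C * t)) (\<lambda>t x. 0)"
    by (rule has_C1I) (use C in \<open>auto simp: \<tau>_def intro!: derivative_eq_intros continuous_intros\<close>)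
  have e_C1: "has_C1 {0..} (\<lambda>t x. exp (C * t)) (\<lambda>t x. C * exp (C * t)) (\<lambda>t x. 0)"
    by (rule has_C1I) (auto intro!: derivative_eq_intros continuous_intros)
  have \<eta>_C1: "has_C1 {0..} \<eta> (\<lambda>t x. C * \<eta> t x - m * exp (C * t)) (\<lambda>t x. exp (C * t))"
    by (rule has_C1I) (auto simp: \<eta>_def[abs_def] algebra_simps intro!: derivative_eq_intros continuous_intros)
  note R' = has_C1_compose[OF R_C1 \<tau>_C1 \<eta>_C1]
  note V' = has_C1_compose[OF V_C1 \<tau>_C1 \<eta>_C1]
  define \<rho>t where "\<rho>t t x = C * \<rho> t x + exp (C * t) * (R1 (\<tau> t) (\<eta> t x) * exp (C * t)
     + R2 (\<tau> t) (\<eta> t x) * (C * \<eta> t x - m * exp (C * t)))" for t x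
  define \<rho>x where "\<rho>x t x = exp (C * t) * (R2 (\<tau> t) (\<eta> t x) * exp (C * t))" for t x
  define ut where "ut t x = V1 (\<tau> t) (\<eta> t x) * exp (C * t)
     + V2 (\<tau> t) (\<eta> t x) * (C * \<eta> t x - m * exp (C * t)) + C * m" for t x
  define ux where "ux t x = V2 (\<tau> t) (\<eta> t x) * exp (C * t) - C" for t x
  have \<rho>_C1: "has_C1 {0..} \<rho> \<rho>t \<rho>x"
    unfolding \<rho>_def[abs_def]
    by (rule has_C1_cong[OF has_C1_mult[OF e_C1 R']])
      (auto simp: \<tau>_nonneg \<rho>t_def \<rho>x_def \<rho>_def algebra_simps)
  have lin_C1: "has_C1 {0..} (\<lambda>t x. m - C * (x - m * t)) (\<lambda>t x. C * m) (\<lambda>t x. - C)"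
    by (rule has_C1I) (auto intro!: derivative_eq_intros continuous_intros)
  have "has_C1 {0..} (\<lambda>t x. 1 * V (\<tau> t) (\<eta> t x) + 1 * (m - C * (x - m * t))) ut ux"
    by (rule has_C1_cong[OF has_C1_lincomb[OF V' lin_C1]])
      (auto simp: \<tau>_nonneg ut_def ux_def)
  also have "(\<lambda>t x. 1 * V (\<tau> t) (\<eta> t x) + 1 * (m - C * (x - m * t))) = u"
    by (simp add: u_def fun_eq_iff)
  finally have u_C1: "has_C1 {0..} u ut ux" .
  have \<rho>_pos: "\<rho> t x > 0" if "t \<ge> 0" for t x
    using R_pos[OF \<tau>_nonneg[OF that]] by (simp add: \<rho>_def)
  have \<rho>_0: "\<rho> 0 = \<rho>0" and u_0: "u 0 = u0"
    by (auto simp: \<rho>_def u_def \<tau>_def \<eta>_def R_0 V_0 v0 fun_eq_iff)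
  have int: "integrable lborel \<rho>0" "integrable lborel (\<lambda>x. \<rho>0 x * u0 x)" and mass: "(LINT x|lborel. \<rho>0 x) = 1"
    using adm by (auto simp: admissible_state_def)
  have W0: "\<rho>0 a * W C 0 a = \<rho>0 a * u0 a - m * \<rho>0 a" for a
    by (simp add: W_0 v0 algebra_simps)
  have int0: "integrable lborel (\<lambda>a. \<rho>0 a * W C 0 a)" and zero: "(LINT a|lborel. \<rho>0 a * W C 0 a) = 0"
    unfolding W0 using int mass by (auto simp: m_def momentum_def)
  have state: "admissible_state (\<rho> t) (u t) \<and> momentum (\<rho> t) (u t) = m" if t: "t \<ge> 0" for t
  proof -
    note \<tau>t = \<tau>_nonneg[OF t]
    define X where "X a = m * t + exp (- (C * t)) * Y (\<tau> t) a" for a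
    define X' where "X' a = exp (- (C * t)) * (\<rho>0 a / R (\<tau> t) (Y (\<tau> t) a))" for a
    have "(Y (\<tau> t) has_real_derivative \<rho>0 a / R (\<tau> t) (Y (\<tau> t) a)) (at a)" for a
      by (rule has_C1_D2[OF Y_C1]) (use \<tau>t in simp)
    then have X: "(X has_real_derivative X' a) (at a)" for a
      unfolding X_def[abs_def] X'_def by (auto intro!: derivative_eq_intros)
    have X'_pos: "X' a > 0" for a
      using R_pos[OF \<tau>t] \<rho>0_pos by (simp add: X'_def)
    have X_surj: "surj X"
    proof (rule surjI)
      fix x
      show "X (inv (Y (\<tau> t)) (exp (C * t) * (x - m * t))) = x"
        by (simp add: X_def surj_f_inv_f[OF Y_surj[OF \<tau>t]] exp_minus field_simps)
    qed
    have \<eta>X: "\<eta> t (X a) = Y (\<tau> t) a" for a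
      by (simp add: \<eta>_def X_def exp_minus)
    have X'\<rho>: "X' a * \<rho> t (X a) = \<rho>0 a" for a
      using R_pos[OF \<tau>t, of "Y (\<tau> t) a"] by (simp add: X'_def \<rho>_def \<eta>X exp_minus)
    have uX: "u t (X a) = m + exp (- (C * t)) * W C (\<tau> t) a" for a
    proof -
      have "X a - m * t = exp (- (C * t)) * Y (\<tau> t) a" by (simp add: X_def)
      then show ?thesis
        unfolding u_def \<eta>X W_def exp_eq[symmetric] by (simp add: algebra_simps flip: exp_add)
    qed
    have c\<rho>: "continuous_on UNIV (\<rho> t)" and cu: "continuous_on UNIV (u t)"
      by (rule has_C1_cont[OF \<rho>_C1] has_C1_cont[OF u_C1]; use t in \<open>auto intro: continuous_intros\<close>)+
    have W: "integrable lborel (\<lambda>a. \<rho>0 a * W C (\<tau> t) a)" "(LINT a|lborel. \<rho>0 a * W C (\<tau> t) a) = 0"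
      using \<rho>0_W_integrable[OF _ \<tau>t int(1) int0] integral_\<rho>0_W[OF _ \<tau>t int(1) int0] C zero by auto
    have eq: "X' a * (\<rho> t (X a) * u t (X a)) = m * \<rho>0 a + exp (- (C * t)) * (\<rho>0 a * W C (\<tau> t) a)" for a
      unfolding mult.assoc[symmetric] X'\<rho> uX by (simp add: algebra_simps)
    have "integrable lborel (\<lambda>a. X' a * (\<rho> t (X a) * u t (X a)))"
      and "(LINT a|lborel. X' a * (\<rho> t (X a) * u t (X a))) = m"
      unfolding eq using int(1) W mass by auto
    with lborel_change_of_variables[OF X X'_pos X_surj continuous_on_mult[OF c\<rho> cu]]
    have "integrable lborel (\<lambda>x. \<rho> t x * u t x)" "momentum (\<rho> t) (u t) = m"
      by (auto simp: momentum_def)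
    moreover have "integrable lborel (\<rho> t)" "(LINT x|lborel. \<rho> t x) = 1"
      using lborel_change_of_variables[OF X X'_pos X_surj c\<rho>] int(1) mass by (auto simp: X'\<rho>)
    ultimately show ?thesis
      using \<rho>_pos[OF t] by (simp add: admissible_state_def)
  qed
  have pde: "deriv (\<lambda>s. \<rho> s x) t + deriv (\<lambda>y. \<rho> t y * u t y) x = 0 \<and>
      deriv (\<lambda>s. u s x) t + u t x * deriv (u t) x + c\<^sup>2 * deriv (\<lambda>y. ln (\<rho> t y)) x = - C * u t x + C * m"
    if t: "t > 0" for t x
  proof -
    have at: "at t within {0..} = at t"
      using t by (intro at_within_interior) simp
    have t0: "t \<in> {0..}" using t by simp
    note \<rho>D = has_C1_D1[OF \<rho>_C1 t0, of x, unfolded at] has_C1_D2[OF \<rho>_C1 t0, of x]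
    note uD = has_C1_D1[OF u_C1 t0, of x, unfolded at] has_C1_D2[OF u_C1 t0, of x]
    have "((\<lambda>y. ln (\<rho> t y)) has_real_derivative \<rho>x t x / \<rho> t x) (at x)"
      using \<rho>D(2) \<rho>_pos[of t x] t by (auto intro!: derivative_eq_intros)
    note D = \<rho>D(1)[THEN DERIV_imp_deriv] DERIV_mult[OF \<rho>D(2) uD(2), THEN DERIV_imp_deriv]
      uD[THEN DERIV_imp_deriv] this[THEN DERIV_imp_deriv]
    define E y where "E = exp (C * t)" and "y = \<eta> t x"
    define r r1 r2 v v1 v2 where "r = R (\<tau> t) y" and "r1 = R1 (\<tau> t) y" and "r2 = R2 (\<tau> t) y"
      and "v = V (\<tau> t) y" and "v1 = V1 (\<tau> t) y" and "v2 = V2 (\<tau> t) y"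
    note defs = E_def[symmetric] y_def[symmetric] r_def[symmetric] r1_def[symmetric] r2_def[symmetric]
      v_def[symmetric] v1_def[symmetric] v2_def[symmetric]
    have \<tau>t: "\<tau> t \<ge> 0" using \<tau>_nonneg t by simp
    have m1: "r1 + v * r2 + r * v2 = 0"
      using mass_eq[OF \<tau>t, of y] by (simp only: defs)
    have m2: "v1 + v * v2 + c\<^sup>2 * (r2 / r) = 0"
      using momentum_eq[OF \<tau>t, of y] by (simp only: defs)
    have r: "r \<noteq> 0" "E \<noteq> 0" using R_pos[OF \<tau>t, of y] by (auto simp: r_def E_def)
    have y: "y = E * (x - m * t)" by (simp add: y_def \<eta>_def E_def)
    have "\<rho>t t x + (\<rho>x t x * u t x + ux t x * \<rho> t x) = E * E * (r1 + v * r2 + r * v2)"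
      unfolding \<rho>t_def \<rho>x_def ux_def u_def \<rho>_def defs unfolding y by (simp add: algebra_simps)
    moreover have "\<rho>x t x / \<rho> t x = E * (r2 / r)"
      unfolding \<rho>x_def \<rho>_def defs using r by simp
    moreover have "ut t x + u t x * ux t x + c\<^sup>2 * (E * (r2 / r)) = - C * u t x + C * m + E * (v1 + v * v2 + c\<^sup>2 * (r2 / r))"
      unfolding ut_def ux_def u_def defs unfolding y by (simp add: algebra_simps)
    ultimately show ?thesis unfolding D using m1 m2 by simp
  qed
  have "classical_solution (c\<^sup>2) C \<rho>0 u0 {0..} \<rho> u"
    unfolding classical_solution_def m_def[symmetric]
    using has_C1_imp_C1_spacetime[OF \<rho>_C1] has_C1_imp_C1_spacetime[OF u_C1] \<rho>_0 u_0 state pde by simp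
  then show ?thesis by blast
qed

section \<open>The pressureless case\<close>

text \<open>Free transport with Jacobian 1 + t d, at least 1 because d is nonnegative. The density
  is rho_0 divided by this Jacobian, so its derivatives involve those of d.\<close>

lemma exists_pressureless_flow:
  fixes \<rho>0 v0 :: "real \<Rightarrow> real"
  assumes \<rho>0: "\<And>x. (\<rho>0 has_real_derivative \<rho>' x) (at x)" "continuous_on UNIV \<rho>'" "\<And>x. \<rho>0 x > 0"
    and v0: "\<And>x. (v0 has_real_derivative d x) (at x)" "\<And>x. d x \<ge> 0"
    and d: "\<And>x. (d has_real_derivative d' x) (at x)" "continuous_on UNIV d'"
  shows "\<exists>R R1 R2 V V1 V2 Y. isothermal_flow 0 0 \<rho>0 v0 R R1 R2 V V1 V2 Y"
proof -
  have d_cont: "continuous_on UNIV d"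
    by (meson DERIV_continuous_on d(1) has_field_derivative_at_within)
  define Y where "Y t a = a + t * v0 a" for t a
  define foot where "foot t y = (SOME a. Y t a = y)" for t y
  define J where "J t y = 1 + t * d (foot t y)" for t y
  have Y_C1: "has_C1 {0..} Y (\<lambda>t a. v0 a) (\<lambda>t a. 1 + t * d a)"
  proof (rule has_C1I)
    have "continuous_on UNIV v0" by (meson DERIV_continuous_on v0(1) has_field_derivative_at_within)
    then show "continuous_on ({0..} \<times> UNIV) (\<lambda>p::real\<times>real. v0 (snd p))"
      by (rule continuous_on_compose2) (auto intro: continuous_intros)
    show "continuous_on ({0..} \<times> UNIV) (\<lambda>p::real\<times>real. 1 + fst p * d (snd p))"
      by (intro continuous_intros continuous_on_compose2[OF d_cont]) auto
  qed (auto simp: Y_def[abs_def] intro!: derivative_eq_intros v0(1))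
  have Y2: "1 + t * d a \<ge> 1" if "t \<ge> 0" for t a using that v0(2) by simp
  have Y_surj: "surj (Y t)" if "t \<ge> 0" for t
    by (rule surj_of_deriv_ge_one[OF has_C1_D2[OF Y_C1] Y2]) (use that in auto)
  have Y_foot: "Y t (foot t y) = y" if t: "t \<ge> 0" for t y
  proof -
    obtain a where "Y t a = y" using Y_surj[OF t] by (metis surjD)
    then show ?thesis unfolding foot_def by (rule someI)
  qed
  have Y_mono: "Y t a < Y t b" if "t \<ge> 0" "a < b" for t a b
  proof (rule DERIV_pos_imp_increasing[OF that(2)])
    fix x show "\<exists>y. (Y t has_real_derivative y) (at x) \<and> 0 < y"
      using has_C1_D2[OF Y_C1, of t x] Y2[OF that(1), of x] that(1) by (intro exI[of _ "1 + t * d x"]) simp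
  qed
  have Y_inj: "a = b" if "t \<ge> 0" "Y t a = Y t b" for t a b
    using Y_mono[of t a b] Y_mono[of t b a] that by (cases a b rule: linorder_cases) auto
  have foot_Y: "foot t (Y t a) = a" if "t \<ge> 0" for t a
    by (rule Y_inj[OF that]) (rule Y_foot[OF that])
  have J_pos: "J t y > 0" if "t \<ge> 0" for t y using Y2[OF that, of "foot t y"] by (simp add: J_def)
  have foot_C1: "has_C1 {0..} foot (\<lambda>t y. - v0 (foot t y) / J t y) (\<lambda>t y. 1 / J t y)"
  proof (rule has_C1_cong[OF has_C1_parametric_inverse[OF Y_C1 _ has_C1_snd]])
    show "1 + t * d a > 0" if "t \<in> {0..}" for t a using Y2[of t a] that by simp
  qed (auto simp: Y_foot J_def)
  define V where "V t y = v0 (foot t y)" for t y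
  define V1 where "V1 t y = d (foot t y) * (- v0 (foot t y) / J t y)" for t y
  define V2 where "V2 t y = d (foot t y) * (1 / J t y)" for t y
  have V_C1: "has_C1 {0..} V V1 V2"
    unfolding V_def[abs_def] V1_def[abs_def] V2_def[abs_def]
    by (rule has_C1_chain[OF foot_C1 v0(1) d_cont])
  define J1 where "J1 t y = d (foot t y) + t * (d' (foot t y) * (- V t y / J t y))" for t y
  define J2 where "J2 t y = t * (d' (foot t y) * (1 / J t y))" for t y
  have td: "has_C1 {0..} (\<lambda>t y. t * d (foot t y))
      (\<lambda>t y. 1 * d (foot t y) + d' (foot t y) * (- V t y / J t y) * t)
      (\<lambda>t y. 0 * d (foot t y) + d' (foot t y) * (1 / J t y) * t)"
    using has_C1_mult[OF has_C1_fst has_C1_chain[OF foot_C1 d]] unfolding V_def .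
  have J_C1: "has_C1 {0..} J J1 J2"
  proof (rule has_C1I)
    fix t y :: real assume t: "t \<in> {0..}"
    show "((\<lambda>s. J s y) has_real_derivative J1 t y) (at t within {0..})"
      using DERIV_add[OF DERIV_const[of 1] has_C1_D1[OF td t, of y]] by (simp add: J_def J1_def mult_ac)
    show "(J t has_real_derivative J2 t y) (at y)"
      using DERIV_add[OF DERIV_const[of 1] has_C1_D2[OF td t, of y]] by (simp add: J_def[abs_def] J2_def mult_ac)
  next
    show "continuous_on ({0..} \<times> UNIV) (\<lambda>p. J1 (fst p) (snd p))"
      "continuous_on ({0..} \<times> UNIV) (\<lambda>p. J2 (fst p) (snd p))"
      using td unfolding has_C1_def J1_def J2_def by (simp_all add: mult_ac)
  qed
  define R where "R t y = \<rho>0 (foot t y) / J t y" for t y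
  define R1 where "R1 t y = (\<rho>' (foot t y) * (- V t y / J t y) * J t y - \<rho>0 (foot t y) * J1 t y) / (J t y * J t y)" for t y
  define R2 where "R2 t y = (\<rho>' (foot t y) * (1 / J t y) * J t y - \<rho>0 (foot t y) * J2 t y) / (J t y * J t y)" for t y
  have R_C1: "has_C1 {0..} R R1 R2"
    unfolding R_def[abs_def] R1_def[abs_def] R2_def[abs_def] V_def
    by (rule has_C1_divide[OF has_C1_chain[OF foot_C1 \<rho>0(1,2)] J_C1]) (use J_pos in \<open>auto simp: less_le\<close>)
  have "isothermal_flow 0 0 \<rho>0 v0 R R1 R2 V V1 V2 Y"
  proof (rule isothermal_flow.intro[OF R_C1 V_C1])
    have foot_0: "foot 0 x = x" for x using Y_foot[of 0 x] by (simp add: Y_def)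
    then show "R 0 x = \<rho>0 x" "V 0 x = v0 x" for x by (simp_all add: R_def V_def J_def)
    show "Y 0 a = a" for a by (simp add: Y_def)
    show "has_C1 {0..} Y (\<lambda>t a. V t (Y t a)) (\<lambda>t a. \<rho>0 a / R t (Y t a))"
      by (rule has_C1_cong[OF Y_C1]) (use \<rho>0(3) in \<open>auto simp: V_def R_def J_def foot_Y less_imp_neq[symmetric]\<close>)
    fix t x :: real assume t: "t \<ge> 0"
    have J: "J t x \<noteq> 0" using J_pos[OF t, of x] by simp
    show "R t x > 0" using J_pos[OF t] \<rho>0(3) by (simp add: R_def)
    show "V2 t x \<ge> 0" using J_pos[OF t, of x] v0(2) by (simp add: V2_def)
    show "V1 t x + V t x * V2 t x + 0\<^sup>2 * (R2 t x / R t x) = 0"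
      by (simp add: V1_def V2_def V_def)
    show "surj (Y t)" by (rule Y_surj[OF t])
    show "R1 t x + V t x * R2 t x + R t x * V2 t x = 0"
      unfolding R1_def R2_def R_def V2_def J1_def J2_def using J by (simp add: field_simps)
  qed simp
  then show ?thesis by blast
qed

text \<open>Without pressure the density is transported along straight characteristics
  \<open>X t\<close>, so \<open>\<partial>X/\<partial>a = \<rho>\<^sub>0 / \<rho>(t, X)\<close> is \<open>C\<^sup>1\<close> and hence so is \<open>u\<^sub>0'\<close>: a loss of one derivative that a
  local classical solution excludes.\<close>

lemma pressureless_local_solution_imp_C2:
  assumes C: "C > 0" and T: "T > 0" and sol: "classical_solution 0 C \<rho>0 u0 {0..<T} \<rho> u"
    and \<rho>0: "\<And>x. (\<rho>0 has_real_derivative \<rho>' x) (at x)" "continuous_on UNIV \<rho>'"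
    and u0: "\<And>x. (u0 has_real_derivative u' x) (at x)" "continuous_on UNIV u'"
  obtains u'' where "\<And>x. (u' has_real_derivative u'' x) (at x)" "continuous_on UNIV u''"
proof -
  define m where "m = momentum \<rho>0 u0"
  obtain \<rho>t \<rho>x where \<rho>_C1: "has_C1 {0..<T} \<rho> \<rho>t \<rho>x"
    using sol C1_spacetime_imp_has_C1 unfolding classical_solution_def by blast
  obtain ut ux where u_C1: "has_C1 {0..<T} u ut ux"
    using sol C1_spacetime_imp_has_C1 unfolding classical_solution_def by blast
  have at: "at t within {0..<T} = at t" if "0 < t" "t < T" for t
    using that by (intro at_within_interior) (simp add: interior_atLeastLessThan)
  have \<rho>_pos: "\<rho> t x > 0" if "t \<in> {0..<T}" for t x
    using sol that by (auto simp: classical_solution_def admissible_state_def)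
  have init: "\<rho> 0 = \<rho>0" "u 0 = u0" using sol by (auto simp: classical_solution_def)
  have pde: "\<rho>t t x + \<rho>x t x * u t x + ux t x * \<rho> t x = 0" "ut t x + u t x * ux t x = - C * u t x + C * m"
    if t: "0 < t" "t < T" for t x
  proof -
    have t': "t \<in> {0..<T}" using t by simp
    note \<rho>D = has_C1_D1[OF \<rho>_C1 t', of x, unfolded at[OF t]] has_C1_D2[OF \<rho>_C1 t', of x]
    note uD = has_C1_D1[OF u_C1 t', of x, unfolded at[OF t]] has_C1_D2[OF u_C1 t', of x]
    note D = \<rho>D(1)[THEN DERIV_imp_deriv] DERIV_mult[OF \<rho>D(2) uD(2), THEN DERIV_imp_deriv] uD[THEN DERIV_imp_deriv]
    have "deriv (\<lambda>s. \<rho> s x) t + deriv (\<lambda>y. \<rho> t y * u t y) x = 0 \<and>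
        deriv (\<lambda>s. u s x) t + u t x * deriv (u t) x + 0 * deriv (\<lambda>y. ln (\<rho> t y)) x = - C * u t x + C * m"
      using sol t' t(1) unfolding classical_solution_def m_def by blast
    then show "\<rho>t t x + \<rho>x t x * u t x + ux t x * \<rho> t x = 0" "ut t x + u t x * ux t x = - C * u t x + C * m"
      unfolding D by simp_all
  qed
  \<comment> \<open>\<open>X\<close> and \<open>U\<close> solve X' = U, U' = - C (U - m) explicitly
    from the initial data; \<open>e\<close> is the integral of the damping factor.\<close>
  define e where "e t = (1 - exp (- (C * t))) / C" for t
  define X where "X t a = a + m * t + (u0 a - m) * e t" for t a
  define U where "U t a = m + (u0 a - m) * exp (- (C * t))" for t a
  have X_t: "((\<lambda>t. X t a) has_real_derivative U t a) (at t within S)" for t a S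
    unfolding X_def e_def U_def using C by (auto intro!: derivative_eq_intros)
  have X_a: "(X t has_real_derivative 1 + u' a * e t) (at a)" for t a
    unfolding X_def[abs_def] by (auto intro!: derivative_eq_intros u0(1))
  have X_cont: "continuous_on S (\<lambda>t. X t a)" for S a
    by (rule DERIV_continuous_on[OF X_t])
  \<comment> \<open>The difference w = u(s, X) - U satisfies w' = - (C + u_x) w with w = 0
    initially; the integrating factor exp P makes it constant. The equation is only known for
    positive times, hence constancy on an open interval plus continuity at its ends.\<close>
  have uX: "u t (X t a) = U t a" if t: "0 < t" "t < T" for t a
  proof -
    define g where "g s = C + ux s (X s a)" for s
    define P where "P s = integral {0..s} g" for s
    define \<phi> where "\<phi> s = (u s (X s a) - U s a) * exp (P s)" for s
    have g: "continuous_on {0..t} g"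
      unfolding g_def using t
      by (intro continuous_intros has_C1_cont_partial(2)[OF u_C1] X_cont) auto
    have P: "(P has_real_derivative g s) (at s within {0..t})" if "s \<in> {0..t}" for s
      unfolding P_def by (rule integral_has_real_derivative[OF g that])
    have u: "((\<lambda>s. u s (X s a)) has_real_derivative ut s (X s a) + ux s (X s a) * U s a) (at s within {0..t})"
      if "s \<in> {0..t}" for s
      by (rule has_C1_curve[OF u_C1 that _ DERIV_ident X_t]) (use t in auto)
    have \<phi>: "(\<phi> has_real_derivative (ut s (X s a) + ux s (X s a) * U s a + C * (U s a - m)) * exp (P s)
        + exp (P s) * g s * (u s (X s a) - U s a)) (at s within {0..t})" if s: "s \<in> {0..t}" for s
      unfolding \<phi>_def
    proof (rule DERIV_mult)
      have "((\<lambda>s. U s a) has_real_derivative - (C * (U s a - m))) (at s within {0..t})"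
        unfolding U_def by (auto intro!: derivative_eq_intros)
      from DERIV_diff[OF u[OF s] this]
      show "((\<lambda>s. u s (X s a) - U s a) has_real_derivative ut s (X s a) + ux s (X s a) * U s a + C * (U s a - m)) (at s within {0..t})"
        by simp
    qed (rule DERIV_chain2[OF DERIV_exp P[OF s]])
    have "\<phi> t = \<phi> 0"
    proof (rule DERIV_isconst_end[OF t(1)])
      show "continuous_on {0..t} \<phi>" by (rule DERIV_continuous_on[OF \<phi>])
      fix s assume s: "0 < s" "s < t"
      then have "ut s (X s a) = - C * u s (X s a) + C * m - u s (X s a) * ux s (X s a)"
        using pde(2)[of s "X s a"] t by simp
      then have "(ut s (X s a) + ux s (X s a) * U s a + C * (U s a - m)) * exp (P s)
        + exp (P s) * g s * (u s (X s a) - U s a) = 0"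
        unfolding g_def by algebra
      then show "(\<phi> has_real_derivative 0) (at s)"
        using \<phi>[of s] s by (simp add: at_within_Icc_at)
    qed
    moreover have "\<phi> 0 = 0" by (simp add: \<phi>_def init X_def U_def e_def)
    ultimately show ?thesis by (simp add: \<phi>_def)
  qed
  \<comment> \<open>Differentiating \<open>uX\<close> in a expresses u_x through the Jacobian of
    \<open>X\<close>; with the continuity equation, density times Jacobian is then constant in
    time.\<close>
  have \<rho>X: "\<rho> t (X t a) * (1 + u' a * e t) = \<rho>0 a" if t: "0 < t" "t < T" for t a
  proof -
    define \<psi> where "\<psi> s = \<rho> s (X s a) * (1 + u' a * e s)" for s
    have \<psi>: "(\<psi> has_real_derivative (\<rho>t s (X s a) + \<rho>x s (X s a) * U s a) * (1 + u' a * e s)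
        + u' a * exp (- (C * s)) * \<rho> s (X s a)) (at s within {0..t})" if s: "s \<in> {0..t}" for s
      unfolding \<psi>_def
    proof (rule DERIV_mult)
      show "((\<lambda>s. \<rho> s (X s a)) has_real_derivative \<rho>t s (X s a) + \<rho>x s (X s a) * U s a) (at s within {0..t})"
        by (rule has_C1_curve[OF \<rho>_C1 s _ DERIV_ident X_t]) (use t in auto)
      show "((\<lambda>s. 1 + u' a * e s) has_real_derivative u' a * exp (- (C * s))) (at s within {0..t})"
        unfolding e_def using C by (auto intro!: derivative_eq_intros)
    qed
    have "\<psi> t = \<psi> 0"
    proof (rule DERIV_isconst_end[OF t(1)])
      show "continuous_on {0..t} \<psi>" by (rule DERIV_continuous_on[OF \<psi>])
      fix s assume s: "0 < s" "s < t"
      then have s': "0 < s" "s < T" "s \<in> {0..<T}" using t by auto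
      have "((\<lambda>a. u s (X s a)) has_real_derivative ux s (X s a) * (1 + u' a * e s)) (at a)"
        by (rule DERIV_chain2[OF has_C1_D2[OF u_C1 s'(3)] X_a])
      moreover have "((\<lambda>a. u s (X s a)) has_real_derivative u' a * exp (- (C * s))) (at a)"
        unfolding uX[OF s'(1,2)] unfolding U_def by (auto intro!: derivative_eq_intros u0(1))
      ultimately have *: "u' a * exp (- (C * s)) = ux s (X s a) * (1 + u' a * e s)"
        by (rule DERIV_unique[rotated])
      have "\<rho>t s (X s a) = - (\<rho>x s (X s a) * U s a) - ux s (X s a) * \<rho> s (X s a)"
        using pde(1)[OF s'(1,2), of "X s a"] uX[OF s'(1,2), of a] by simp
      then have "(\<rho>t s (X s a) + \<rho>x s (X s a) * U s a) * (1 + u' a * e s)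
        + u' a * exp (- (C * s)) * \<rho> s (X s a) = 0"
        unfolding * by algebra
      then show "(\<psi> has_real_derivative 0) (at s)"
        using \<psi>[of s] s by (simp add: at_within_Icc_at)
    qed
    then show ?thesis by (simp add: \<psi>_def init X_def e_def)
  qed
  \<comment> \<open>An interior time will do: \<open>e t\<close> is positive, so the mass relation
    can be solved for u', with a right-hand side that is C1 in a.\<close>
  define t where "t = T / 2"
  have t: "0 < t" "t < T" "t \<in> {0..<T}" using T by (auto simp: t_def)
  have et: "e t > 0" using C t by (simp add: e_def)
  have u'_eq: "u' a = (\<rho>0 a / \<rho> t (X t a) - 1) / e t" for a
    using \<rho>X[OF t(1,2), of a] \<rho>_pos[OF t(3), of "X t a"] et by (simp add: field_simps)
  define u'' where "u'' a = (\<rho>' a * \<rho> t (X t a) - \<rho>0 a * (\<rho>x t (X t a) * (1 + u' a * e t)))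
     / (\<rho> t (X t a) * \<rho> t (X t a)) / e t" for a
  have nz: "\<rho> t x \<noteq> 0" for x using \<rho>_pos[OF t(3), of x] by simp
  have D: "((\<lambda>a. (\<rho>0 a / \<rho> t (X t a) - 1) / e t) has_real_derivative u'' a) (at a)" for a
  proof -
    have "((\<lambda>a. \<rho> t (X t a)) has_real_derivative \<rho>x t (X t a) * (1 + u' a * e t)) (at a)"
      by (rule DERIV_chain2[OF has_C1_D2[OF \<rho>_C1 t(3)] X_a])
    from DERIV_divide[OF \<rho>0(1) this nz]
    have "((\<lambda>a. \<rho>0 a / \<rho> t (X t a) - 1) has_real_derivative (\<rho>' a * \<rho> t (X t a) - \<rho>0 a * (\<rho>x t (X t a) * (1 + u' a * e t)))
     / (\<rho> t (X t a) * \<rho> t (X t a)) - 0) (at a)"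
      by (intro DERIV_diff DERIV_const)
    then show ?thesis unfolding u''_def by (intro DERIV_cdivide) simp
  qed
  show thesis
  proof (rule that[of u''])
    show "(u' has_real_derivative u'' x) (at x)" for x
      using D[of x] by (simp flip: u'_eq)
    have Xc: "continuous_on UNIV (X t)"
      by (meson DERIV_continuous_on X_a has_field_derivative_at_within)
    have \<rho>0c: "continuous_on UNIV \<rho>0"
      by (meson DERIV_continuous_on \<rho>0(1) has_field_derivative_at_within)
    have "continuous_on UNIV (\<lambda>a. \<rho> t (X t a))" "continuous_on UNIV (\<lambda>a. \<rho>x t (X t a))"
      using t(3) by (auto intro!: has_C1_cont[OF \<rho>_C1 continuous_on_const Xc] has_C1_cont_partial(2)[OF \<rho>_C1 continuous_on_const Xc])
    then show "continuous_on UNIV u''"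
      unfolding u''_def using et nz by (intro continuous_intros \<rho>0(2) u0(2) \<rho>0c) auto
  qed
qed

section \<open>Global solutions\<close>

text \<open>By continuity the set where the bound fails is open, and an open null set is
  empty.\<close>

lemma AE_abs_le_continuous:
  fixes f :: "real \<Rightarrow> real"
  assumes f: "continuous_on UNIV f" and ae: "AE x in lborel. \<bar>f x\<bar> \<le> M"
  shows "\<bar>f x\<bar> \<le> M"
proof -
  let ?S = "{x. M < \<bar>f x\<bar>}"
  have "open ?S"
    by (intro open_Collect_less continuous_intros f)
  moreover have "?S \<in> null_sets lborel"
    using ae \<open>open ?S\<close> by (subst AE_iff_null_sets) (auto simp: not_less)
  then have "negligible ?S"
    using negligible_iff_null_sets null_sets_completionI by blast
  ultimately have "?S = {}"
    using open_not_negligible by blast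
  then show ?thesis by (auto simp: not_less)
qed

lemma Linfty_continuous_bounded:
  assumes "Linfty f" "continuous_on UNIV f"
  obtains M where "\<And>x. \<bar>f x\<bar> \<le> M"
  using assms AE_abs_le_continuous unfolding Linfty_def by metis

lemma C1_differentiable_on_UNIV_deriv:
  fixes f :: "real \<Rightarrow> real"
  assumes "f C1_differentiable_on UNIV"
  shows "(f has_real_derivative deriv f x) (at x)" and "continuous_on UNIV (deriv f)"
proof -
  obtain D where D: "\<And>x. (f has_real_derivative D x) (at x)" and c: "continuous_on UNIV D"
    using assms by (auto simp: C1_differentiable_on_def simp flip: has_real_derivative_iff_has_vector_derivative)
  have "deriv f = D" using DERIV_imp_deriv[OF D] by (rule ext)
  with D c show "(f has_real_derivative deriv f x) (at x)" "continuous_on UNIV (deriv f)" by simp_all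
qed

theorem theorem4p1:
  fixes A C :: real and \<rho>0 u0 :: "real \<Rightarrow> real"
  assumes "C > 0" and "A \<ge> 0"
    and "admissible_state \<rho>0 u0"
    and "\<rho>0 C1_differentiable_on UNIV" and "u0 C1_differentiable_on UNIV"
    and local_existence: "\<exists>T>0. \<exists>\<rho> u. classical_solution A C \<rho>0 u0 {0..<T} \<rho> u"
    and "Linfty (\<lambda>x. deriv u0 x + sqrt A * (deriv \<rho>0 x / \<rho>0 x))"
    and "Linfty (\<lambda>x. deriv u0 x - sqrt A * (deriv \<rho>0 x / \<rho>0 x))"
    and "\<forall>x. deriv u0 x \<ge> - C + sqrt A * \<bar>deriv \<rho>0 x / \<rho>0 x\<bar>"
  shows "\<exists>\<rho> u. classical_solution A C \<rho>0 u0 {0..} \<rho> u"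
proof -
  define c where "c = sqrt A"
  define m where "m = momentum \<rho>0 u0"
  define v0 where "v0 x = u0 x - m + C * x" for x
  note \<rho>0 = C1_differentiable_on_UNIV_deriv[OF assms(4)]
  note u0 = C1_differentiable_on_UNIV_deriv[OF assms(5)]
  have \<rho>0_pos: "\<rho>0 x > 0" for x using assms(3) by (simp add: admissible_state_def)
  have c2: "c\<^sup>2 = A" and c_ge: "c \<ge> 0" using assms(2) by (simp_all add: c_def)
  have v0_D: "(v0 has_real_derivative deriv u0 x + C) (at x)" for x
    unfolding v0_def[abs_def] by (auto intro!: derivative_eq_intros u0(1))
  have lower: "c * \<bar>deriv \<rho>0 x / \<rho>0 x\<bar> \<le> deriv u0 x + C" for x
    using assms(9)[rule_format, of x] by (simp add: c_def)
  have "\<exists>K R R1 R2 V V1 V2 Y. isothermal_flow c K \<rho>0 v0 R R1 R2 V V1 V2 Y"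
  \<comment> \<open>For A = 0 the two families of characteristics coincide, so a pair of feet no
    longer gives coordinates and the coefficients with 1 / (4 c) lose their meaning.\<close>
  proof (cases "A = 0")
    case True
    obtain T \<rho> u where "T > 0" "classical_solution 0 C \<rho>0 u0 {0..<T} \<rho> u"
      using local_existence True by blast
    then obtain u'' where u'': "\<And>x. (deriv u0 has_real_derivative u'' x) (at x)" "continuous_on UNIV u''"
      using pressureless_local_solution_imp_C2[OF assms(1) _ _ \<rho>0 u0] by blast
    have "\<exists>R R1 R2 V V1 V2 Y. isothermal_flow 0 0 \<rho>0 v0 R R1 R2 V V1 V2 Y"
    proof (rule exists_pressureless_flow[OF \<rho>0 \<rho>0_pos v0_D _ _ u''(2)])
      show "0 \<le> deriv u0 x + C" for x using lower[of x] True by (simp add: c_def)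
      show "((\<lambda>x. deriv u0 x + C) has_real_derivative u'' x) (at x)" for x
        using DERIV_add[OF u''(1) DERIV_const[of C]] by simp
    qed
    moreover have "c = 0" using True by (simp add: c_def)
    ultimately show ?thesis by blast
  next
    case False
    then have c: "c > 0" using assms(2) by (simp add: c_def)
    define r where "r x = v0 x + c * ln (\<rho>0 x)" for x
    define s where "s x = v0 x - c * ln (\<rho>0 x)" for x
    define r' where "r' x = deriv u0 x + C + c * (deriv \<rho>0 x / \<rho>0 x)" for x
    define s' where "s' x = deriv u0 x + C - c * (deriv \<rho>0 x / \<rho>0 x)" for x
    have ln_D: "((\<lambda>x. c * ln (\<rho>0 x)) has_real_derivative c * (deriv \<rho>0 x / \<rho>0 x)) (at x)" for x
      using \<rho>0_pos by (auto intro!: derivative_eq_intros \<rho>0(1))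
    have r: "(r has_real_derivative r' x) (at x)" and s: "(s has_real_derivative s' x) (at x)" for x
      unfolding r_def[abs_def] s_def[abs_def] r'_def s'_def
      by (intro DERIV_add DERIV_diff v0_D ln_D)+
    have "continuous_on UNIV \<rho>0"
      by (meson DERIV_continuous_on \<rho>0(1) has_field_derivative_at_within)
    then have q: "continuous_on UNIV (\<lambda>x. deriv \<rho>0 x / \<rho>0 x)"
      using \<rho>0_pos by (intro continuous_intros \<rho>0(2)) (auto simp: less_le)
    have r'_cont: "continuous_on UNIV r'" and s'_cont: "continuous_on UNIV s'"
      unfolding r'_def[abs_def] s'_def[abs_def] by (intro continuous_intros u0(2) q)+
    have "continuous_on UNIV (\<lambda>x. deriv u0 x + c * (deriv \<rho>0 x / \<rho>0 x))"
      "continuous_on UNIV (\<lambda>x. deriv u0 x - c * (deriv \<rho>0 x / \<rho>0 x))"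
      by (intro continuous_intros u0(2) q)+
    note cont = this
    obtain M1 where M1: "\<And>x. \<bar>deriv u0 x + c * (deriv \<rho>0 x / \<rho>0 x)\<bar> \<le> M1"
      using Linfty_continuous_bounded[OF assms(7)[folded c_def] cont(1)] by blast
    obtain M2 where M2: "\<And>x. \<bar>deriv u0 x - c * (deriv \<rho>0 x / \<rho>0 x)\<bar> \<le> M2"
      using Linfty_continuous_bounded[OF assms(8)[folded c_def] cont(2)] by blast
    \<comment> \<open>The bounds \<open>M1\<close> and \<open>M2\<close> concern derivatives of the
      data for u; the summand C comes from the term C x in \<open>v0\<close>.\<close>
    define M where "M = max M1 M2 + C"
    have ge: "0 \<le> r' x" "0 \<le> s' x" for x
    proof -
      have "\<bar>c * (deriv \<rho>0 x / \<rho>0 x)\<bar> \<le> deriv u0 x + C"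
        using lower[of x] c_ge unfolding abs_mult by simp
      then show "0 \<le> r' x" "0 \<le> s' x" by (auto simp only: r'_def s'_def abs_le_iff)
    qed
    have le: "r' x \<le> M" "s' x \<le> M" for x
      using M1[of x] M2[of x] by (auto simp: r'_def s'_def M_def)
    have scale: "continuous_on UNIV (\<lambda>x. f x / (4 * c))" "0 \<le> f x / (4 * c)" "f x / (4 * c) \<le> M / (4 * c)"
      if "continuous_on UNIV f" "\<And>x. 0 \<le> f x" "\<And>x. f x \<le> M" for f x
      using that c by (auto intro!: continuous_intros divide_right_mono)
    obtain \<gamma> :: "real \<Rightarrow> real \<Rightarrow> real" where \<gamma>: "continuous_on UNIV (\<lambda>p. \<gamma> (fst p) (snd p))"
      "\<And>a b. 0 \<le> \<gamma> a b"
      "\<And>a b. \<gamma> a b = s' b / (4 * c) * (1 + integral {a..b} (\<gamma> a)) + r' a / (4 * c) * (1 + integral {a..b} (\<lambda>z. \<gamma> z b))"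
      using exists_nonneg_goursat_solution[OF scale[OF r'_cont ge(1) le(1)] scale[OF s'_cont ge(2) le(2)]] by blast
    interpret rarefactive_data c M r s r' s' \<gamma>
      by (rule rarefactive_data.intro[OF c r r'_cont ge(1) le(1) s s'_cont ge(2) le(2) \<gamma>])
    have "\<rho>0 x = exp ((r x - s x) / (2 * c))" "v0 x = (r x + s x) / 2" for x
      using c \<rho>0_pos[of x] by (simp_all add: r_def s_def)
    then show ?thesis using exists_isothermal_flow by blast
  qed
  then obtain K R R1 R2 V V1 V2 Y where "isothermal_flow c K \<rho>0 v0 R R1 R2 V V1 V2 Y" by blast
  then show ?thesis
    using isothermal_flow.classical_solution_of_flow[OF _ assms(1,3)] c2 unfolding v0_def m_def by blast
qed

end
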